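(* Let $\Theta\subset\mathbb{R}^q$ be open, and let $\{(T_\theta,\psi_\theta):\theta\in\Theta\}$ be a family such that each $T_\theta$ is a forward expansive correspondence on a compact metric space $X_\theta$ and $\psi_\theta\in C(\Gamma_{T_\theta},\mathbb{R})$. Assume that every $(T_\theta,\psi_\theta)$ satisfies the $C^\omega$ Legendre assumptions, has unique linear equilibrium pairs, and has a rotation interval symmetric about $0$. Suppose that the linear pressures $P_\theta(y)=P(T_\theta,y\psi_\theta)$ are even in $y$, depend real analytically on $(\theta,y)$ near $\Theta\times\{0\}$, and are such that $y/P_\theta'(y)$ is strictly increasing for $y>0$ (here $'$ is $d/dy$). Write, near $y=0$, $$P_\theta'(y)=a(\theta)y+\sum_{j=1}^\infty c_j(\theta)y^{2j+1},\qquad a(\theta)=P_\theta''(0)>0,$$ and for $k\in\{1,2,\dots\}$ define $\mathcal{S}_k=\{\theta\in\Theta:c_1(\theta)=\cdots=c_{k-1}(\theta)=0,\ c_k(\theta)<0\}$ (no vanishing condition when $k=1$). Consider the energies $\mathcal{E}_{\beta,\theta}(\gamma)=\frac\beta2\bigl(\int\psi_\theta\,d\gamma\bigr)^2$, $\beta\ge0$. Then: (i) For $\theta\in\mathcal{S}_k$ the critical inverse temperature is $\beta_c(\theta)=1/a(\theta)$ and, as $\beta\to\beta_c(\theta)^+$ with $\theta$ fixed, the positive nonlinear equilibrium value $z_{\beta,\theta}>0$ satisfies $$z_{\beta,\theta}\sim C(\theta)(\beta-\beta_c(\theta))^{1/(2k)},\qquad C(\theta):=a(\theta)\Bigl(\frac{a(\theta)^2}{-c_k(\theta)}\Bigr)^{1/(2k)}.$$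 The formulas for $\beta_c$ and $C$ are restrictions of real-analytic functions on the open set where $a>0$ and $c_k<0$. In particular, the critical exponent of the positive equilibrium value is constant, equal to $1/(2k)$, on $\mathcal{S}_k$. (ii) If $\theta'\in\Theta$ is a perturbation of a point of $\mathcal{S}_k$ at which the first nonzero coefficient among $c_1(\theta'),c_2(\theta'),\dots$ is $c_j(\theta')<0$ with $j<k$, then the critical exponent of the positive equilibrium value at $\theta'$ is $1/(2j)$.
   Context: For a compact metric space $Y$, $\mathcal{M}(Y)$ is the set of Borel probability measures on $Y$ with the weak-star topology. Logarithms are natural. Correspondences. Let $(X,d)$ be a compact metric space. A correspondence $T$ on $X$ assigns to each $x\in X$ a nonempty closed set $T(x)\subset X$ such that $\Gamma_T=\{(x,y)\in X^2:y\in T(x)\}$ is closed in $X^2$. Set $\mathcal{O}_{n+1}(T)=\{(x_0,\dots,x_n)\in X^{n+1}:x_{j+1}\in T(x_j),\ 0\le j<n\}$ with metric $d_{n+1}(\boldsymbol{x},\boldsymbol{y})=\max_{0\le j\le n}d(x_j,y_j)$. The orbit space is $\Omega_T=\{(x_j)_{j\ge0}:x_{j+1}\in T(x_j)\ \forall j\ge 0\}$. $T$ is forward expansive if there is $\varepsilon_0>0$ such that any two distinct $\boldsymbol{x},\boldsymbol{y}\in\Omega_T$ satisfy $d(x_j,y_j)>\varepsilon_0$ for some $j\ge0$. Stationary transition pairs. $\mathcal{K}(X;T)$ is the set of Borel transition probability kernels $Q$ on $X$ with $\operatorname{supp}Q_x\subseteq T(x)$ for every $x$. $\mathcal{M}(X,Q)=\{\mu\in\mathcal{M}(X):\mu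 Q=\mu\}$, $(\mu Q)(A)=\int_XQ_x(A)\,d\mu(x)$. A stationary transition pair is $(\mu,Q)$ with $Q\in\mathcal{K}(X;T)$, $\mu\in\mathcal{M}(X,Q)$; its two-coordinate distribution is $\gamma_{\mu,Q}(dx,dy)=\mu(dx)Q_x(dy)$, an element of $\mathcal{M}(\Gamma_T)$. Kernels agreeing $\mu$-almost everywhere are identified. Kernel entropy. Let $\mu Q^{[n-1]}$ be the law on $X^n$ of $(x_0,\dots,x_{n-1})$ for the Markov process with initial law $\mu$ and kernel $Q$. For a finite Borel partition $\mathcal{A}$ of $X$ with product partition $\mathcal{A}^{\times n}$, $h_\mu(Q,\mathcal{A})=\lim_{n}\frac1nH_{\mu Q^{[n-1]}}(\mathcal{A}^{\times n})$, where $H_\lambda(\mathcal{B})=-\sum_{B\in\mathcal{B}}\lambda(B)\log\lambda(B)$, and $h_\mu(Q)=\sup_{\mathcal{A}}h_\mu(Q,\mathcal{A})$. A nonlinear equilibrium pair for a continuous $\mathcal{E}:\mathcal{M}(\Gamma_T)\to\mathbb{R}$ is a stationary transition pair maximizing $h_\mu(Q)+\mathcal{E}(\gamma_{\mu,Q})$ among all stationary transition pairs; nonlinear equilibrium values are the rotation values $\int\psi\,d\gamma_{\mu,Q}$ of nonlinear equilibrium pairs. For the energies $\mathcal{E}_{\beta,\theta}$, the critical inverse temperature is the threshold $\beta_c(\theta)$ such that $0$ is the unique equilibrium value for $0\le\beta\le\beta_c(\theta)$, while for $\beta>\beta_c(\theta)$ there are exactly two equilibrium values $\pm z_{\beta,\theta}$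 with $z_{\beta,\theta}>0$ (the positive equilibrium value). Its critical exponent is the number $\alpha$ such that $z_{\beta,\theta}\sim C(\beta-\beta_c(\theta))^{\alpha}$ as $\beta\downarrow\beta_c(\theta)$ for some $C>0$; $f\sim g$ means $f/g\to1$. Linear pressure. For $\varphi\in C(\Gamma_T,\mathbb{R})$, $P(T,\varphi)=\lim_{\varepsilon\to0^+}\limsup_n\frac1n\log\sup_{\mathcal{C}}\sum_{\boldsymbol x\in\mathcal{C}}\exp\bigl(\sum_{j=0}^{n-1}\varphi(x_j,x_{j+1})\bigr)$, the supremum over $\mathcal{C}\subset\mathcal{O}_{n+1}(T)$ whose distinct elements are at $d_{n+1}$-distance greater than $\varepsilon$; for forward expansive $T$ it equals $\sup\{h_\mu(Q)+\int\varphi\,d\gamma_{\mu,Q}\}$ over stationary transition pairs, and $\mathsf{Eq}(T,\varphi)$ is the set of pairs attaining this supremum (linear equilibrium pairs). $(T,\psi)$ has unique linear equilibrium pairs if $\mathsf{Eq}(T,y\psi)$ consists of exactly one pair (modulo the identification above) for every $y\in\mathbb{R}$. Rotation interval and localized entropy. $\mathcal{R}(\psi)=\{\int\psi\,d\gamma_{\mu,Q}:(\mu,Q)\text{ stationary transition pair}\}\subset\mathbb{R}$; for $z\in\mathcal{R}(\psi)$, $\mathfrak{h}(z)=\sup\{h_\mu(Q):\int\psi\,d\gamma_{\mu,Q}=z\}$. $C^\omega$ Legendre assumptions for $(T,\psi)$, with $P(y)=P(T,y\psi)$: (i) $\mathcal{R}(\psi)$ has nonempty interior; (ii) $\mathfrak{h}$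 is finite and upper semicontinuous on $\mathcal{R}(\psi)$, and is real analytic and strictly concave on its interior; (iii) $P$ is real analytic and strictly convex, and $P':\mathbb{R}\to\operatorname{int}\mathcal{R}(\psi)$ is a homeomorphism such that it and its inverse are real analytic; (iv) $\mathfrak{h}(z)=\inf_{y\in\mathbb{R}}(P(y)-yz)$ for all $z\in\mathcal{R}(\psi)$. *)

theory Defs
  imports "HOL-Probability.Probability" "HOL-Library.Landau_Symbols"
begin

section \<open>Real analyticity, semicontinuity, strict convexity\<close>

text \<open>
  Local expansion in a convergent multivariate power series; multi-indices are functions on the
  ambient space that vanish off the orthonormal basis \<^term>\<open>Basis\<close>. It is only used for open
  sets \<open>S\<close>.
\<close>

definition multi_indices :: "('a::euclidean_space \<Rightarrow> nat) set" where
  "multi_indices = {\<alpha>. \<forall>b. b \<notin> Basis \<longrightarrow> \<alpha> b = 0}"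

definition real_analytic_on :: "('a::euclidean_space \<Rightarrow> real) \<Rightarrow> 'a set \<Rightarrow> bool" where
  "real_analytic_on f S \<longleftrightarrow>
     (\<forall>x\<in>S. \<exists>r>0. \<exists>A :: ('a \<Rightarrow> nat) \<Rightarrow> real. \<forall>y\<in>ball x r.
        ((\<lambda>\<alpha>. A \<alpha> * (\<Prod>b\<in>Basis. ((y - x) \<bullet> b) ^ \<alpha> b)) has_sum f y) multi_indices)"

definition usc_on :: "real set \<Rightarrow> (real \<Rightarrow> ereal) \<Rightarrow> bool" where
  "usc_on S f \<longleftrightarrow> (\<forall>x\<in>S. \<forall>c. f x < c \<longrightarrow> (\<forall>\<^sub>F y in at x within S. f y < c))"

definition strictly_convex_on :: "real set \<Rightarrow> (real \<Rightarrow> real) \<Rightarrow> bool" where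
  "strictly_convex_on S f \<longleftrightarrow> convex S \<and>
     (\<forall>x\<in>S. \<forall>y\<in>S. \<forall>t. x \<noteq> y \<and> 0 < t \<and> t < 1 \<longrightarrow>
        f ((1 - t) * x + t * y) < (1 - t) * f x + t * f y)"

definition strictly_concave_on :: "real set \<Rightarrow> (real \<Rightarrow> real) \<Rightarrow> bool" where
  "strictly_concave_on S f \<longleftrightarrow> strictly_convex_on S (\<lambda>x. - f x)"


section \<open>Correspondences\<close>

definition graph_of :: "'a metric \<Rightarrow> ('a \<Rightarrow> 'a set) \<Rightarrow> ('a \<times> 'a) set" where
  "graph_of X T = {(x, y). x \<in> mspace X \<and> y \<in> mspace X \<and> y \<in> T x}"

definition correspondence :: "'a metric \<Rightarrow> ('a \<Rightarrow> 'a set) \<Rightarrow> bool" where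
  "correspondence X T \<longleftrightarrow>
     (\<forall>x\<in>mspace X. T x \<noteq> {} \<and> closedin (mtopology_of X) (T x)) \<and>
     closedin (prod_topology (mtopology_of X) (mtopology_of X)) (graph_of X T)"

definition graph_topology :: "'a metric \<Rightarrow> ('a \<Rightarrow> 'a set) \<Rightarrow> ('a \<times> 'a) topology" where
  "graph_topology X T =
     subtopology (prod_topology (mtopology_of X) (mtopology_of X)) (graph_of X T)"

definition orbit_space :: "'a metric \<Rightarrow> ('a \<Rightarrow> 'a set) \<Rightarrow> (nat \<Rightarrow> 'a) set" where
  "orbit_space X T = {x. \<forall>j. x j \<in> mspace X \<and> x (Suc j) \<in> T (x j)}"

definition forward_expansive :: "'a metric \<Rightarrow> ('a \<Rightarrow> 'a set) \<Rightarrow> bool" where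
  "forward_expansive X T \<longleftrightarrow>
     (\<exists>\<epsilon>0>0. \<forall>x\<in>orbit_space X T. \<forall>y\<in>orbit_space X T.
        x \<noteq> y \<longrightarrow> (\<exists>j. mdist X (x j) (y j) > \<epsilon>0))"

text \<open>\<open>orbit_segments X T n\<close> is \<open>\<O>\<^bsub>n+1\<^esub>(T)\<close>, with \<open>X\<^bsup>n+1\<^esup>\<close> rendered as the extensional functions
  on \<open>{..n}\<close>.\<close>

definition orbit_segments :: "'a metric \<Rightarrow> ('a \<Rightarrow> 'a set) \<Rightarrow> nat \<Rightarrow> (nat \<Rightarrow> 'a) set" where
  "orbit_segments X T n =
     {x \<in> {..n} \<rightarrow>\<^sub>E mspace X. \<forall>j<n. x (Suc j) \<in> T (x j)}"

definition segment_dist :: "'a metric \<Rightarrow> nat \<Rightarrow> (nat \<Rightarrow> 'a) \<Rightarrow> (nat \<Rightarrow> 'a) \<Rightarrow> real" where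
  "segment_dist X n x y = (MAX j\<in>{..n}. mdist X (x j) (y j))"

definition separated_segments ::
    "'a metric \<Rightarrow> ('a \<Rightarrow> 'a set) \<Rightarrow> nat \<Rightarrow> real \<Rightarrow> (nat \<Rightarrow> 'a) set set" where
  "separated_segments X T n \<epsilon> =
     {C. C \<subseteq> orbit_segments X T n \<and> (\<forall>x\<in>C. \<forall>y\<in>C. x \<noteq> y \<longrightarrow> segment_dist X n x y > \<epsilon>)}"


section \<open>Linear pressure\<close>

text \<open>
  On a compact space and for \<open>\<epsilon> > 0\<close>, separated sets are finite with uniformly bounded cardinality,
  so for continuous \<open>\<phi>\<close> the sums and the supremum below are those of ordinary real analysis.
  The outer limit exists in the extended reals by monotonicity in \<open>\<epsilon>\<close>.
\<close>

definition partition_sum ::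
    "'a metric \<Rightarrow> ('a \<Rightarrow> 'a set) \<Rightarrow> ('a \<times> 'a \<Rightarrow> real) \<Rightarrow> real \<Rightarrow> nat \<Rightarrow> real" where
  "partition_sum X T \<phi> \<epsilon> n =
     (SUP C\<in>separated_segments X T n \<epsilon>. \<Sum>x\<in>C. exp (\<Sum>j<n. \<phi> (x j, x (Suc j))))"

definition pressure :: "'a metric \<Rightarrow> ('a \<Rightarrow> 'a set) \<Rightarrow> ('a \<times> 'a \<Rightarrow> real) \<Rightarrow> ereal" where
  "pressure X T \<phi> =
     Lim (at_right 0) (\<lambda>\<epsilon>. limsup (\<lambda>n. ereal (1 / real n * ln (partition_sum X T \<phi> \<epsilon> n))))"


section \<open>Stationary transition pairs\<close>

definition borel_of :: "'a topology \<Rightarrow> 'a measure" where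
  "borel_of S = sigma (topspace S) {U. openin S U}"

abbreviation mborel :: "'a metric \<Rightarrow> 'a measure" where
  "mborel X \<equiv> borel_of (mtopology_of X)"

definition msupport :: "'a metric \<Rightarrow> 'a measure \<Rightarrow> 'a set" where
  "msupport X \<mu> =
     {x \<in> mspace X. \<forall>U. openin (mtopology_of X) U \<and> x \<in> U \<longrightarrow> emeasure \<mu> U > 0}"

definition transition_kernels :: "'a metric \<Rightarrow> ('a \<Rightarrow> 'a set) \<Rightarrow> ('a \<Rightarrow> 'a measure) set" where
  "transition_kernels X T =
     {Q \<in> mborel X \<rightarrow>\<^sub>M prob_algebra (mborel X). \<forall>x\<in>mspace X. msupport X (Q x) \<subseteq> T x}"

text \<open>The Giry bind \<open>\<mu> \<bind> Q\<close> is the measure \<open>\<mu>Q\<close>, \<open>A \<mapsto> \<integral> Q\<^sub>x(A) d\<mu>(x)\<close>.\<close>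

definition stationary_pairs ::
    "'a metric \<Rightarrow> ('a \<Rightarrow> 'a set) \<Rightarrow> ('a measure \<times> ('a \<Rightarrow> 'a measure)) set" where
  "stationary_pairs X T =
     {(\<mu>, Q). \<mu> \<in> space (prob_algebra (mborel X)) \<and> Q \<in> transition_kernels X T \<and> \<mu> \<bind> Q = \<mu>}"

text \<open>
  The measure \<open>\<mu>(dx)Q\<^sub>x(dy)\<close>, as a measure on the graph of \<open>T\<close>, where it is concentrated. Since
  \<open>X\<close> is second countable, the product sigma-algebra is the Borel sigma-algebra of \<open>X\<^sup>2\<close>.
\<close>

definition two_coord ::
    "'a metric \<Rightarrow> ('a \<Rightarrow> 'a set) \<Rightarrow> 'a measure \<times> ('a \<Rightarrow> 'a measure) \<Rightarrow> ('a \<times> 'a) measure" where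
  "two_coord X T = (\<lambda>(\<mu>, Q).
     restrict_space
       (\<mu> \<bind> (\<lambda>x. distr (Q x) (mborel X \<Otimes>\<^sub>M mborel X) (\<lambda>y. (x, y))))
       (graph_of X T))"


section \<open>Kernel entropy\<close>

text \<open>\<open>path_law X \<mu> Q n\<close> is \<open>\<mu>Q\<^bsup>[n]\<^esup>\<close>, the law of \<open>(x\<^sub>0, \<dots>, x\<^sub>n)\<close>, a measure on \<open>X\<^bsup>n+1\<^esup>\<close>.\<close>

primrec path_law ::
    "'a metric \<Rightarrow> 'a measure \<Rightarrow> ('a \<Rightarrow> 'a measure) \<Rightarrow> nat \<Rightarrow> (nat \<Rightarrow> 'a) measure" where
  "path_law X \<mu> Q 0 = distr \<mu> (\<Pi>\<^sub>M i\<in>{..<1}. mborel X) (\<lambda>x. \<lambda>i\<in>{..<1}. x)"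
| "path_law X \<mu> Q (Suc n) = path_law X \<mu> Q n \<bind>
     (\<lambda>w. distr (Q (w n)) (\<Pi>\<^sub>M i\<in>{..<Suc (Suc n)}. mborel X) (\<lambda>y. w(Suc n := y)))"

definition borel_partitions :: "'a metric \<Rightarrow> 'a set set set" where
  "borel_partitions X = {\<A>. finite \<A> \<and> \<A> \<subseteq> sets (mborel X) \<and> partition_on (mspace X) \<A>}"

definition product_partition :: "'a set set \<Rightarrow> nat \<Rightarrow> (nat \<Rightarrow> 'a) set set" where
  "product_partition \<A> n = (\<lambda>A. \<Pi>\<^sub>E i\<in>{..<n}. A i) ` ({..<n} \<rightarrow>\<^sub>E \<A>)"

definition partition_entropy :: "'b measure \<Rightarrow> 'b set set \<Rightarrow> real" where
  "partition_entropy M \<B> = - (\<Sum>B\<in>\<B>. measure M B * ln (measure M B))"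

definition kernel_entropy_partition ::
    "'a metric \<Rightarrow> 'a measure \<times> ('a \<Rightarrow> 'a measure) \<Rightarrow> 'a set set \<Rightarrow> real" where
  "kernel_entropy_partition X = (\<lambda>(\<mu>, Q) \<A>.
     lim (\<lambda>n. 1 / real n * partition_entropy (path_law X \<mu> Q (n - 1)) (product_partition \<A> n)))"

definition kernel_entropy :: "'a metric \<Rightarrow> 'a measure \<times> ('a \<Rightarrow> 'a measure) \<Rightarrow> ereal" where
  "kernel_entropy X p = (SUP \<A>\<in>borel_partitions X. ereal (kernel_entropy_partition X p \<A>))"


section \<open>Equilibrium pairs\<close>

definition linear_equilibrium_pairs ::
    "'a metric \<Rightarrow> ('a \<Rightarrow> 'a set) \<Rightarrow> ('a \<times> 'a \<Rightarrow> real) \<Rightarrow>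
      ('a measure \<times> ('a \<Rightarrow> 'a measure)) set" where
  "linear_equilibrium_pairs X T \<phi> =
     {p \<in> stationary_pairs X T.
        kernel_entropy X p + ereal (\<integral>w. \<phi> w \<partial>two_coord X T p) =
        (SUP p'\<in>stationary_pairs X T.
           kernel_entropy X p' + ereal (\<integral>w. \<phi> w \<partial>two_coord X T p'))}"

definition pair_equiv ::
    "'a measure \<times> ('a \<Rightarrow> 'a measure) \<Rightarrow> 'a measure \<times> ('a \<Rightarrow> 'a measure) \<Rightarrow> bool" where
  "pair_equiv = (\<lambda>(\<mu>, Q) (\<mu>', Q'). \<mu> = \<mu>' \<and> (AE x in \<mu>. Q x = Q' x))"

definition unique_linear_equilibrium_pairs ::
    "'a metric \<Rightarrow> ('a \<Rightarrow> 'a set) \<Rightarrow> ('a \<times> 'a \<Rightarrow> real) \<Rightarrow> bool" where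
  "unique_linear_equilibrium_pairs X T \<psi> \<longleftrightarrow>
     (\<forall>y::real. \<exists>p\<in>linear_equilibrium_pairs X T (\<lambda>w. y * \<psi> w).
        \<forall>p'\<in>linear_equilibrium_pairs X T (\<lambda>w. y * \<psi> w). pair_equiv p p')"

definition nonlinear_equilibrium_pairs ::
    "'a metric \<Rightarrow> ('a \<Rightarrow> 'a set) \<Rightarrow> (('a \<times> 'a) measure \<Rightarrow> real) \<Rightarrow>
      ('a measure \<times> ('a \<Rightarrow> 'a measure)) set" where
  "nonlinear_equilibrium_pairs X T \<E> =
     {p \<in> stationary_pairs X T. \<forall>p'\<in>stationary_pairs X T.
        kernel_entropy X p' + ereal (\<E> (two_coord X T p')) \<le>
        kernel_entropy X p + ereal (\<E> (two_coord X T p))}"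


section \<open>Rotation set, localized entropy, Legendre assumptions\<close>

definition rotation_value ::
    "'a metric \<Rightarrow> ('a \<Rightarrow> 'a set) \<Rightarrow> ('a \<times> 'a \<Rightarrow> real) \<Rightarrow>
      'a measure \<times> ('a \<Rightarrow> 'a measure) \<Rightarrow> real" where
  "rotation_value X T \<psi> p = (\<integral>w. \<psi> w \<partial>two_coord X T p)"

definition rotation_set :: "'a metric \<Rightarrow> ('a \<Rightarrow> 'a set) \<Rightarrow> ('a \<times> 'a \<Rightarrow> real) \<Rightarrow> real set" where
  "rotation_set X T \<psi> = rotation_value X T \<psi> ` stationary_pairs X T"

definition localized_entropy ::
    "'a metric \<Rightarrow> ('a \<Rightarrow> 'a set) \<Rightarrow> ('a \<times> 'a \<Rightarrow> real) \<Rightarrow> real \<Rightarrow> ereal" where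
  "localized_entropy X T \<psi> z =
     (SUP p\<in>{p \<in> stationary_pairs X T. rotation_value X T \<psi> p = z}. kernel_entropy X p)"

definition pressure_fun ::
    "'a metric \<Rightarrow> ('a \<Rightarrow> 'a set) \<Rightarrow> ('a \<times> 'a \<Rightarrow> real) \<Rightarrow> real \<Rightarrow> real" where
  "pressure_fun X T \<psi> y = real_of_ereal (pressure X T (\<lambda>w. y * \<psi> w))"

definition legendre_assumptions ::
    "'a metric \<Rightarrow> ('a \<Rightarrow> 'a set) \<Rightarrow> ('a \<times> 'a \<Rightarrow> real) \<Rightarrow> bool" where
  "legendre_assumptions X T \<psi> \<longleftrightarrow>
     (let R = rotation_set X T \<psi>; h = localized_entropy X T \<psi>; P = pressure_fun X T \<psi> in
        interior R \<noteq> {} \<and>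
        (\<forall>z\<in>R. \<bar>h z\<bar> \<noteq> \<infinity>) \<and> usc_on R h \<and>
        real_analytic_on (\<lambda>z. real_of_ereal (h z)) (interior R) \<and>
        strictly_concave_on (interior R) (\<lambda>z. real_of_ereal (h z)) \<and>
        (\<forall>y. \<bar>pressure X T (\<lambda>w. y * \<psi> w)\<bar> \<noteq> \<infinity>) \<and>
        real_analytic_on P UNIV \<and> strictly_convex_on UNIV P \<and>
        (\<exists>g. homeomorphism UNIV (interior R) (deriv P) g \<and>
             real_analytic_on (deriv P) UNIV \<and> real_analytic_on g (interior R)) \<and>
        (\<forall>z\<in>R. h z = (INF y. ereal (P y - y * z))))"


section \<open>Quadratic energies and their critical behaviour\<close>

definition quadratic_energy ::
    "('a \<times> 'a \<Rightarrow> real) \<Rightarrow> real \<Rightarrow> ('a \<times> 'a) measure \<Rightarrow> real" where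
  "quadratic_energy \<psi> \<beta> \<gamma> = \<beta> / 2 * (\<integral>w. \<psi> w \<partial>\<gamma>)\<^sup>2"

definition equilibrium_values ::
    "'a metric \<Rightarrow> ('a \<Rightarrow> 'a set) \<Rightarrow> ('a \<times> 'a \<Rightarrow> real) \<Rightarrow> real \<Rightarrow> real set" where
  "equilibrium_values X T \<psi> \<beta> =
     rotation_value X T \<psi> ` nonlinear_equilibrium_pairs X T (quadratic_energy \<psi> \<beta>)"

text \<open>There is at most one such \<open>\<beta>\<^sub>c\<close>.\<close>

definition is_critical_inverse_temperature ::
    "'a metric \<Rightarrow> ('a \<Rightarrow> 'a set) \<Rightarrow> ('a \<times> 'a \<Rightarrow> real) \<Rightarrow> real \<Rightarrow> bool" where
  "is_critical_inverse_temperature X T \<psi> \<beta>\<^sub>c \<longleftrightarrow> 0 \<le> \<beta>\<^sub>c \<and>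
     (\<forall>\<beta>. 0 \<le> \<beta> \<and> \<beta> \<le> \<beta>\<^sub>c \<longrightarrow> equilibrium_values X T \<psi> \<beta> = {0}) \<and>
     (\<forall>\<beta>>\<beta>\<^sub>c. \<exists>z>0. equilibrium_values X T \<psi> \<beta> = {z, - z})"

definition positive_equilibrium_value ::
    "'a metric \<Rightarrow> ('a \<Rightarrow> 'a set) \<Rightarrow> ('a \<times> 'a \<Rightarrow> real) \<Rightarrow> real \<Rightarrow> real" where
  "positive_equilibrium_value X T \<psi> \<beta> = (THE z. z > 0 \<and> z \<in> equilibrium_values X T \<psi> \<beta>)"

definition is_critical_exponent ::
    "'a metric \<Rightarrow> ('a \<Rightarrow> 'a set) \<Rightarrow> ('a \<times> 'a \<Rightarrow> real) \<Rightarrow> real \<Rightarrow> bool" where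
  "is_critical_exponent X T \<psi> \<alpha> \<longleftrightarrow>
     (\<exists>\<beta>\<^sub>c C. is_critical_inverse_temperature X T \<psi> \<beta>\<^sub>c \<and> C > 0 \<and>
        positive_equilibrium_value X T \<psi> \<sim>[at_right \<beta>\<^sub>c] (\<lambda>\<beta>. C * (\<beta> - \<beta>\<^sub>c) powr \<alpha>))"

text \<open>
  Taylor coefficients at \<open>0\<close> of the derivative of \<open>P\<close>, which is odd when \<open>P\<close> is even:
  \<open>P'(y) = a y + (\<Sum>j\<ge>1. c\<^sub>j y\<^bsup>2j+1\<^esup>)\<close>, with \<open>a = P''(0)\<close>.
\<close>

definition pressure_lin_coeff :: "(real \<Rightarrow> real) \<Rightarrow> real" where
  "pressure_lin_coeff P = deriv (deriv P) 0"

definition pressure_odd_coeff :: "(real \<Rightarrow> real) \<Rightarrow> nat \<Rightarrow> real" where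
  "pressure_odd_coeff P j = (deriv ^^ (2 * j + 1)) (deriv P) 0 / fact (2 * j + 1)"

definition stratum :: "'p set \<Rightarrow> ('p \<Rightarrow> nat \<Rightarrow> real) \<Rightarrow> nat \<Rightarrow> 'p set" where
  "stratum \<Theta> c k = {\<theta>\<in>\<Theta>. (\<forall>j. 1 \<le> j \<and> j < k \<longrightarrow> c \<theta> j = 0) \<and> c \<theta> k < 0}"

end

theory Submission
  imports Defs
begin

text \<open>
  Fix a parameter \<open>\<theta>\<close>, write \<open>P\<close> for the pressure function and \<open>h(p)\<close> for kernel entropy. The
  Legendre formula gives, for every stationary pair \<open>p\<close> with rotation value \<open>z\<close> and every \<open>y\<close>, the
  bound \<open>h(p) \<le> P(y) - y z\<close>; the linear equilibrium pair for \<open>y \<psi>\<close> has rotation value \<open>P'(y)\<close> and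
  attains it. For \<open>\<beta> > 0\<close>, inserting \<open>y = \<beta> z\<close> yields \<open>h(p) + \<beta> z\<^sup>2 / 2 \<le> \<Phi>(\<beta> z)\<close> with
  \<open>\<Phi>(y) = P(y) - y\<^sup>2 / (2 \<beta>)\<close>, with equality at the linear equilibrium pair of any \<open>y\<close> with
  \<open>P'(y) = y / \<beta>\<close>. The nonlinear problem thus reduces to maximizing the even function \<open>\<Phi>\<close> on the
  line, and its equilibrium values are \<open>y / \<beta>\<close> for the maximizers \<open>y\<close>. This is
  \<open>even_pressure_system.equilibrium_values_eq\<close>.

  For \<open>y > 0\<close> the sign of \<open>\<Phi>'(y) = P'(y) - y / \<beta>\<close> is that of \<open>\<beta> - y / P'(y)\<close>. The ratio \<open>y / P'(y)\<close>
  increases strictly from its limit \<open>1 / a\<close> at \<open>0\<close>, and it is unbounded because \<open>P'\<close> takes values in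
  the rotation set, which is bounded since \<open>\<psi>\<close> is continuous on the compact graph. Hence \<open>0\<close> is
  the only maximizer for \<open>0 < \<beta> \<le> 1 / a\<close>, and for \<open>\<beta> > 1 / a\<close> the maximizers are \<open>\<plusminus> Y\<close>, where \<open>Y > 0\<close>
  is the unique solution of \<open>Y / P'(Y) = \<beta>\<close>. Moreover \<open>Y \<rightarrow> 0\<close> as \<open>\<beta> \<down> 1 / a\<close>, so that for \<open>\<theta> \<in> \<S>\<^sub>k\<close>
  one has \<open>a - 1 / \<beta> = a - P'(Y) / Y \<sim> - c\<^sub>k Y\<^bsup>2k\<^esup>\<close>; solving for \<open>Y\<close> and dividing by \<open>\<beta>\<close> gives the
  asymptotics.

  For the dependence on \<open>\<theta>\<close>, the Taylor coefficients in \<open>y\<close> of a jointly analytic function are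
  analytic in \<open>\<theta>\<close> (\<open>real_analytic_on_coefficient\<close>), and analytic functions are stable under linear
  combinations, \<open>exp\<close> and \<open>ln\<close>. Products and powers are not needed separately, because
  \<open>1 / a = exp (- ln a)\<close> and \<open>C = exp ((1 + 1 / k) ln a - (1 / (2 k)) ln (- c\<^sub>k))\<close>.
\<close>

section \<open>Multivariate power series\<close>

text \<open>
  The monomial \<open>u\<^sup>\<alpha>\<close> and the degree \<open>|\<alpha>|\<close>, taken over the coordinates of the orthonormal basis.
\<close>

definition multi_power :: "'a::euclidean_space \<Rightarrow> ('a \<Rightarrow> nat) \<Rightarrow> real" where
  "multi_power u \<alpha> = (\<Prod>b\<in>Basis. (u \<bullet> b) ^ \<alpha> b)"

definition multi_degree :: "('a::euclidean_space \<Rightarrow> nat) \<Rightarrow> nat" where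
  "multi_degree \<alpha> = (\<Sum>b\<in>Basis. \<alpha> b)"

text \<open>
  A local expansion of \<open>f\<close> at \<open>x\<close> with coefficients \<open>A\<close>, majorized on the polydisc of radius \<open>\<rho>\<close>:
  \<open>\<Sum> |A\<^sub>\<alpha>| \<rho>\<^bsup>|\<alpha>|\<^esup> < \<infinity>\<close>, and the series represents \<open>f\<close> on the closed ball of radius \<open>\<rho>\<close>. Having the
  majorant explicitly makes all later rearrangements instances of absolute summability.
\<close>

definition expansion_at ::
    "('a::euclidean_space \<Rightarrow> real) \<Rightarrow> 'a \<Rightarrow> (('a \<Rightarrow> nat) \<Rightarrow> real) \<Rightarrow> real \<Rightarrow> bool" where
  "expansion_at f x A \<rho> \<longleftrightarrow> 0 < \<rho> \<and>
     (\<lambda>\<alpha>. \<bar>A \<alpha>\<bar> * \<rho> ^ multi_degree \<alpha>) summable_on multi_indices \<and>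
     (\<forall>u. norm u \<le> \<rho> \<longrightarrow> ((\<lambda>\<alpha>. A \<alpha> * multi_power u \<alpha>) has_sum f (x + u)) multi_indices)"

lemma abs_multi_power_le: "\<bar>multi_power u \<alpha>\<bar> \<le> norm u ^ multi_degree \<alpha>"
proof -
  have "\<bar>multi_power u \<alpha>\<bar> = (\<Prod>b\<in>Basis. \<bar>u \<bullet> b\<bar> ^ \<alpha> b)"
    by (simp add: multi_power_def abs_prod power_abs)
  also have "\<dots> \<le> (\<Prod>b\<in>Basis. norm u ^ \<alpha> b)"
    by (intro prod_mono conjI power_mono) (auto simp: Basis_le_norm)
  also have "\<dots> = norm u ^ multi_degree \<alpha>"
    by (simp add: multi_degree_def power_sum)
  finally show ?thesis .
qed

lemma abs_multi_power_le':
  assumes "norm u \<le> \<rho>"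
  shows "\<bar>multi_power u \<alpha>\<bar> \<le> \<rho> ^ multi_degree \<alpha>"
  using abs_multi_power_le[of u \<alpha>] power_mono[OF assms, of "multi_degree \<alpha>"] by simp

lemma multi_power_zero: "multi_power u (\<lambda>_. 0) = 1"
  by (simp add: multi_power_def)

lemma multi_power_add: "multi_power u (\<lambda>b. \<alpha> b + \<beta> b) = multi_power u \<alpha> * multi_power u \<beta>"
  by (simp add: multi_power_def power_add prod.distrib)

lemma multi_degree_add: "multi_degree (\<lambda>b. \<alpha> b + \<beta> b) = multi_degree \<alpha> + multi_degree \<beta>"
  by (simp add: multi_degree_def sum.distrib)

lemma multi_degree_pos:
  assumes "\<alpha> \<in> multi_indices - {\<lambda>_. 0}"
  obtains d where "multi_degree \<alpha> = Suc d"
proof -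
  from assms obtain b where b: "\<alpha> b \<noteq> 0" by auto
  with assms have "b \<in> Basis" by (auto simp: multi_indices_def)
  with b have "multi_degree \<alpha> \<noteq> 0"
    by (auto simp: multi_degree_def)
  thus ?thesis using that not0_implies_Suc by blast
qed

text \<open>
  Unconditional summability over multi-indices is absolute, so evaluating the given series at a point
  of the ball all of whose coordinates equal \<open>\<rho>\<close> produces the majorant.
\<close>

lemma real_analytic_on_iff_expansion:
  "real_analytic_on f S \<longleftrightarrow> (\<forall>x\<in>S. \<exists>A \<rho>. expansion_at f x A \<rho>)"
proof (intro iffI ballI)
  fix x assume "real_analytic_on f S" "x \<in> S"
  then obtain r A where r: "r > 0"
    and A: "\<And>y. y \<in> ball x r \<Longrightarrow>
        ((\<lambda>\<alpha>. A \<alpha> * (\<Prod>b\<in>Basis. ((y - x) \<bullet> b) ^ \<alpha> b)) has_sum f y) multi_indices"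
    unfolding real_analytic_on_def by blast
  define \<rho> where "\<rho> = r / (2 * DIM('a))"
  have dim: "real DIM('a) \<ge> 1" using DIM_positive[where 'a='a] by linarith
  have \<rho>: "\<rho> > 0" using r dim by (simp add: \<rho>_def)
  define u0 :: 'a where "u0 = (\<Sum>b\<in>Basis. \<rho> *\<^sub>R b)"
  have "norm u0 \<le> (\<Sum>b\<in>(Basis::'a set). norm (\<rho> *\<^sub>R b))"
    unfolding u0_def by (rule norm_sum)
  also have "\<dots> = DIM('a) * \<rho>" using \<rho> by simp
  also have "\<dots> < r" using r dim by (simp add: \<rho>_def)
  finally have u0: "norm u0 < r" .
  have "\<rho> \<le> DIM('a) * \<rho>" using dim \<rho> by simp
  also have "\<dots> < r" using r dim by (simp add: \<rho>_def)
  finally have "\<rho> < r" .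
  have "multi_power u0 \<alpha> = \<rho> ^ multi_degree \<alpha>" for \<alpha>
    by (simp add: multi_power_def u0_def multi_degree_def power_sum)
  moreover have "(\<lambda>\<alpha>. A \<alpha> * multi_power u0 \<alpha>) summable_on multi_indices"
    using A[of "x + u0"] u0 by (auto simp: dist_norm multi_power_def summable_on_def)
  ultimately have "(\<lambda>\<alpha>. \<bar>A \<alpha>\<bar> * \<rho> ^ multi_degree \<alpha>) summable_on multi_indices"
    using \<rho> by (subst (asm) summable_on_iff_abs_summable_on_real) (simp add: abs_mult)
  moreover have "((\<lambda>\<alpha>. A \<alpha> * multi_power u \<alpha>) has_sum f (x + u)) multi_indices"
    if "norm u \<le> \<rho>" for u
    using A[of "x + u"] that \<open>\<rho> < r\<close> by (auto simp: dist_norm multi_power_def)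
  ultimately show "\<exists>A \<rho>. expansion_at f x A \<rho>"
    using \<rho> unfolding expansion_at_def by blast
next
  assume *: "\<forall>x\<in>S. \<exists>A \<rho>. expansion_at f x A \<rho>"
  show "real_analytic_on f S"
    unfolding real_analytic_on_def
  proof (intro ballI)
    fix x assume "x \<in> S"
    with * obtain A \<rho> where e: "expansion_at f x A \<rho>" by blast
    show "\<exists>r>0. \<exists>A. \<forall>y\<in>ball x r.
       ((\<lambda>\<alpha>. A \<alpha> * (\<Prod>b\<in>Basis. ((y - x) \<bullet> b) ^ \<alpha> b)) has_sum f y) multi_indices"
    proof (intro exI[of _ \<rho>] conjI exI[of _ A] ballI)
      show "\<rho> > 0" using e by (simp add: expansion_at_def)
      fix y assume "y \<in> ball x \<rho>"
      hence "norm (y - x) \<le> \<rho>" by (simp add: dist_norm norm_minus_commute)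
      with e have "((\<lambda>\<alpha>. A \<alpha> * multi_power (y - x) \<alpha>) has_sum f (x + (y - x))) multi_indices"
        unfolding expansion_at_def by blast
      thus "((\<lambda>\<alpha>. A \<alpha> * (\<Prod>b\<in>Basis. ((y - x) \<bullet> b) ^ \<alpha> b)) has_sum f y) multi_indices"
        by (simp add: multi_power_def)
    qed
  qed
qed

lemma expansion_at_shrink:
  assumes "expansion_at f x A \<rho>" "0 < \<sigma>" "\<sigma> \<le> \<rho>"
  shows "expansion_at f x A \<sigma>"
proof -
  have "(\<lambda>\<alpha>. \<bar>A \<alpha>\<bar> * \<sigma> ^ multi_degree \<alpha>) summable_on multi_indices"
    by (rule summable_on_comparison_test[where f = "\<lambda>\<alpha>. \<bar>A \<alpha>\<bar> * \<rho> ^ multi_degree \<alpha>"])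
      (use assms in \<open>auto simp: expansion_at_def intro!: mult_left_mono power_mono\<close>)
  thus ?thesis using assms unfolding expansion_at_def by auto
qed

lemma expansion_at_linear_combination:
  assumes "expansion_at f x A \<rho>" "expansion_at g x B \<sigma>"
  shows "expansion_at (\<lambda>y. s * f y + t * g y) x (\<lambda>\<alpha>. s * A \<alpha> + t * B \<alpha>) (min \<rho> \<sigma>)"
proof -
  let ?\<tau> = "min \<rho> \<sigma>"
  have A: "expansion_at f x A ?\<tau>" and B: "expansion_at g x B ?\<tau>"
    using expansion_at_shrink[OF assms(1), of ?\<tau>] expansion_at_shrink[OF assms(2), of ?\<tau>] assms
    by (simp_all add: expansion_at_def)
  have "(\<lambda>\<alpha>. \<bar>s\<bar> * (\<bar>A \<alpha>\<bar> * ?\<tau> ^ multi_degree \<alpha>) + \<bar>t\<bar> * (\<bar>B \<alpha>\<bar> * ?\<tau> ^ multi_degree \<alpha>))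
      summable_on multi_indices"
    using A B unfolding expansion_at_def
    by (intro summable_on_add summable_on_cmult_right) auto
  hence "(\<lambda>\<alpha>. \<bar>s * A \<alpha> + t * B \<alpha>\<bar> * ?\<tau> ^ multi_degree \<alpha>) summable_on multi_indices"
  proof (rule summable_on_comparison_test)
    fix \<alpha> :: "'a \<Rightarrow> nat"
    have \<tau>: "?\<tau> \<ge> 0" using A by (simp add: expansion_at_def)
    have "\<bar>s * A \<alpha> + t * B \<alpha>\<bar> \<le> \<bar>s\<bar> * \<bar>A \<alpha>\<bar> + \<bar>t\<bar> * \<bar>B \<alpha>\<bar>"
      by (metis abs_mult abs_triangle_ineq)
    from mult_right_mono[OF this, of "?\<tau> ^ multi_degree \<alpha>"] \<tau>
    show "\<bar>s * A \<alpha> + t * B \<alpha>\<bar> * ?\<tau> ^ multi_degree \<alpha> \<le>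
        \<bar>s\<bar> * (\<bar>A \<alpha>\<bar> * ?\<tau> ^ multi_degree \<alpha>) + \<bar>t\<bar> * (\<bar>B \<alpha>\<bar> * ?\<tau> ^ multi_degree \<alpha>)"
      by (simp add: algebra_simps)
    show "0 \<le> \<bar>s * A \<alpha> + t * B \<alpha>\<bar> * ?\<tau> ^ multi_degree \<alpha>" using \<tau> by simp
  qed
  moreover have "((\<lambda>\<alpha>. (s * A \<alpha> + t * B \<alpha>) * multi_power u \<alpha>) has_sum
      (s * f (x + u) + t * g (x + u))) multi_indices" if "norm u \<le> ?\<tau>" for u
  proof -
    have "((\<lambda>\<alpha>. s * (A \<alpha> * multi_power u \<alpha>) + t * (B \<alpha> * multi_power u \<alpha>)) has_sum
      (s * f (x + u) + t * g (x + u))) multi_indices"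
      using A B that unfolding expansion_at_def
      by (intro has_sum_add has_sum_cmult_right) auto
    thus ?thesis by (simp add: algebra_simps)
  qed
  ultimately show ?thesis using A by (simp add: expansion_at_def)
qed

lemma real_analytic_on_linear_combination:
  assumes "real_analytic_on f S" "real_analytic_on g S"
  shows "real_analytic_on (\<lambda>y. s * f y + t * g y) S"
  unfolding real_analytic_on_iff_expansion
proof
  fix x assume "x \<in> S"
  with assms obtain A \<rho> B \<sigma> where "expansion_at f x A \<rho>" "expansion_at g x B \<sigma>"
    unfolding real_analytic_on_iff_expansion by blast
  from expansion_at_linear_combination[OF this]
  show "\<exists>A \<rho>. expansion_at (\<lambda>y. s * f y + t * g y) x A \<rho>" by blast
qed

lemma expansion_at_center:
  assumes e: "expansion_at f x A \<rho>"
  shows "f x = A (\<lambda>_. 0)"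
proof -
  let ?z = "(\<lambda>_. 0) :: 'a \<Rightarrow> nat"
  have "((\<lambda>\<alpha>. A \<alpha> * multi_power 0 \<alpha>) has_sum f (x + 0)) multi_indices"
    using e unfolding expansion_at_def by (metis less_imp_le norm_zero)
  moreover have "((\<lambda>\<alpha>. A \<alpha> * multi_power 0 \<alpha>) has_sum A ?z) multi_indices \<longleftrightarrow>
      ((\<lambda>\<alpha>. A \<alpha> * multi_power 0 \<alpha>) has_sum A ?z) {?z}"
  proof (rule has_sum_cong_neutral)
    show "A \<alpha> * multi_power 0 \<alpha> = 0" if \<alpha>: "\<alpha> \<in> multi_indices - {?z}" for \<alpha>
    proof -
      obtain d where "multi_degree \<alpha> = Suc d" using multi_degree_pos[OF \<alpha>] .
      thus ?thesis using abs_multi_power_le[of 0 \<alpha>] by simp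
    qed
  qed (auto simp: multi_indices_def)
  moreover have "((\<lambda>\<alpha>. A \<alpha> * multi_power 0 \<alpha>) has_sum A ?z) {?z}"
    by (rule has_sum_finiteI) (auto simp: multi_power_zero)
  ultimately show ?thesis by (auto dest: has_sum_unique)
qed

lemma expansion_at_increment:
  assumes e: "expansion_at f x A \<rho>" and u: "norm u \<le> \<rho>"
  shows "((\<lambda>\<alpha>. A \<alpha> * multi_power u \<alpha>) has_sum (f (x + u) - f x)) (multi_indices - {\<lambda>_. 0})"
proof -
  have "((\<lambda>\<alpha>. A \<alpha> * multi_power u \<alpha>) has_sum f (x + u)) multi_indices"
    using e u unfolding expansion_at_def by auto
  moreover have "((\<lambda>\<alpha>. A \<alpha> * multi_power u \<alpha>) has_sum f x) {\<lambda>_. 0}"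
    unfolding expansion_at_center[OF e] by (rule has_sum_finiteI) (auto simp: multi_power_zero)
  ultimately show ?thesis by (intro has_sum_Diff) (auto simp: multi_indices_def)
qed

lemma expansion_at_isCont:
  assumes e: "expansion_at f x A \<rho>"
  shows "isCont f x"
proof -
  let ?J = "multi_indices - {(\<lambda>_. 0) :: 'a \<Rightarrow> nat}"
  define K where "K = infsum (\<lambda>\<alpha>. \<bar>A \<alpha>\<bar> * \<rho> ^ multi_degree \<alpha>) ?J"
  have \<rho>: "\<rho> > 0" using e by (simp add: expansion_at_def)
  have K: "((\<lambda>\<alpha>. \<bar>A \<alpha>\<bar> * \<rho> ^ multi_degree \<alpha>) has_sum K) ?J"
    unfolding K_def using e
    by (intro has_sum_infsum) (auto simp: expansion_at_def intro: summable_on_subset_banach)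
  have bound: "norm (f (x + u) - f x) \<le> (norm u / \<rho>) * K" if u: "norm u \<le> \<rho>" for u
  proof -
    note expansion_at_increment[OF e u]
    moreover have "((\<lambda>\<alpha>. (norm u / \<rho>) * (\<bar>A \<alpha>\<bar> * \<rho> ^ multi_degree \<alpha>)) has_sum ((norm u / \<rho>) * K)) ?J"
      using K by (rule has_sum_cmult_right)
    moreover have "norm (A \<alpha> * multi_power u \<alpha>) \<le> (norm u / \<rho>) * (\<bar>A \<alpha>\<bar> * \<rho> ^ multi_degree \<alpha>)"
      if "\<alpha> \<in> ?J" for \<alpha>
    proof -
      obtain d where d: "multi_degree \<alpha> = Suc d" using multi_degree_pos[OF \<open>\<alpha> \<in> ?J\<close>] .
      have "\<bar>multi_power u \<alpha>\<bar> \<le> norm u * norm u ^ d"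
        using abs_multi_power_le[of u \<alpha>] d by simp
      also have "\<dots> \<le> norm u * \<rho> ^ d" by (intro mult_left_mono power_mono u) auto
      also have "\<dots> = norm u / \<rho> * \<rho> ^ multi_degree \<alpha>" using \<rho> d by simp
      finally have "\<bar>A \<alpha>\<bar> * \<bar>multi_power u \<alpha>\<bar> \<le> \<bar>A \<alpha>\<bar> * (norm u / \<rho> * \<rho> ^ multi_degree \<alpha>)"
        by (rule mult_left_mono) simp
      thus ?thesis by (simp add: abs_mult mult_ac)
    qed
    ultimately show ?thesis by (rule norm_infsum_le)
  qed
  have "((\<lambda>u. f (x + u) - f x) \<longlongrightarrow> 0) (at 0)"
  proof (rule Lim_null_comparison)
    show "\<forall>\<^sub>F u in at 0. norm (f (x + u) - f x) \<le> (norm u / \<rho>) * K"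
      unfolding eventually_at using \<rho> bound by (intro exI[of _ \<rho>]) (auto simp: dist_norm)
    show "((\<lambda>u::'a. (norm u / \<rho>) * K) \<longlongrightarrow> 0) (at 0)"
      using \<rho> by (auto intro!: tendsto_eq_intros)
  qed
  thus ?thesis
    unfolding isCont_iff by (subst Lim_null)
qed

text \<open>
  Collecting the terms of a series that carry the same multi-index.
\<close>

lemma has_sum_fibres:
  fixes c :: "'i \<Rightarrow> real"
  assumes sum: "((\<lambda>i. c i * w (m i)) has_sum t) I"
    and m: "\<And>i. i \<in> I \<Longrightarrow> m i \<in> J"
    and c: "\<And>\<alpha>. c summable_on {i\<in>I. m i = \<alpha>}"
  shows "((\<lambda>\<alpha>. infsum c {i\<in>I. m i = \<alpha>} * w \<alpha>) has_sum t) J"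
proof (rule has_sum_SigmaD)
  have bij: "bij_betw snd (SIGMA \<alpha>:J. {i\<in>I. m i = \<alpha>}) I"
    unfolding bij_betw_def using m by (auto simp: inj_on_def image_iff)
  show "((\<lambda>p. c (snd p) * w (m (snd p))) has_sum t) (SIGMA \<alpha>:J. {i\<in>I. m i = \<alpha>})"
    using sum by (subst has_sum_reindex_bij_betw[OF bij])
  fix \<alpha> assume "\<alpha> \<in> J"
  have "((\<lambda>i. c i * w \<alpha>) has_sum infsum c {i\<in>I. m i = \<alpha>} * w \<alpha>) {i\<in>I. m i = \<alpha>}"
    by (intro has_sum_cmult_left has_sum_infsum c)
  thus "((\<lambda>i. c (snd (\<alpha>, i)) * w (m (snd (\<alpha>, i)))) has_sum
      infsum c {i\<in>I. m i = \<alpha>} * w \<alpha>) {i\<in>I. m i = \<alpha>}"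
    by (rule has_sum_cong[THEN iffD1, rotated]) auto
qed

text \<open>
  A majorized series of monomials indexed by an arbitrary set \<open>I\<close>, in which a monomial may occur
  repeatedly, is a local expansion. Compositions and partial Taylor coefficients are both obtained
  from this lemma by choosing \<open>I\<close>.
\<close>

lemma expansion_at_regroup:
  fixes c :: "'i \<Rightarrow> real" and m :: "'i \<Rightarrow> 'a::euclidean_space \<Rightarrow> nat"
  assumes \<rho>: "0 < \<rho>"
    and m: "\<And>i. i \<in> I \<Longrightarrow> m i \<in> multi_indices"
    and s: "(\<lambda>i. \<bar>c i\<bar> * \<rho> ^ multi_degree (m i)) summable_on I"
    and f: "\<And>u. norm u \<le> \<rho> \<Longrightarrow> ((\<lambda>i. c i * multi_power u (m i)) has_sum f (x + u)) I"
  shows "expansion_at f x (\<lambda>\<alpha>. infsum c {i\<in>I. m i = \<alpha>}) \<rho>"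
proof -
  have abs: "(\<lambda>i. \<bar>c i\<bar>) summable_on {i\<in>I. m i = \<alpha>}" for \<alpha>
  proof -
    have "(\<lambda>i. \<bar>c i\<bar> * \<rho> ^ multi_degree (m i)) summable_on {i\<in>I. m i = \<alpha>}"
      using s by (rule summable_on_subset_banach) auto
    hence "(\<lambda>i. \<bar>c i\<bar> * \<rho> ^ multi_degree \<alpha>) summable_on {i\<in>I. m i = \<alpha>}"
      by (rule summable_on_cong[THEN iffD1, rotated]) auto
    thus ?thesis using \<rho> by (subst (asm) summable_on_cmult_left') auto
  qed
  hence c: "c summable_on {i\<in>I. m i = \<alpha>}" for \<alpha>
    by (simp add: summable_on_iff_abs_summable_on_real[of c])
  have "((\<lambda>\<alpha>. infsum (\<lambda>i. \<bar>c i\<bar>) {i\<in>I. m i = \<alpha>} * \<rho> ^ multi_degree \<alpha>) has_sum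
     infsum (\<lambda>i. \<bar>c i\<bar> * \<rho> ^ multi_degree (m i)) I) multi_indices"
    by (intro has_sum_fibres has_sum_infsum s m abs)
  hence "(\<lambda>\<alpha>. infsum (\<lambda>i. \<bar>c i\<bar>) {i\<in>I. m i = \<alpha>} * \<rho> ^ multi_degree \<alpha>) summable_on multi_indices"
    by (rule has_sum_imp_summable)
  hence "(\<lambda>\<alpha>. \<bar>infsum c {i\<in>I. m i = \<alpha>}\<bar> * \<rho> ^ multi_degree \<alpha>) summable_on multi_indices"
  proof (rule summable_on_comparison_test)
    fix \<alpha>
    have "\<bar>infsum c {i\<in>I. m i = \<alpha>}\<bar> \<le> infsum (\<lambda>i. \<bar>c i\<bar>) {i\<in>I. m i = \<alpha>}"
      using norm_infsum_bound[of c "{i\<in>I. m i = \<alpha>}"] abs by simp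
    thus "\<bar>infsum c {i\<in>I. m i = \<alpha>}\<bar> * \<rho> ^ multi_degree \<alpha> \<le>
        infsum (\<lambda>i. \<bar>c i\<bar>) {i\<in>I. m i = \<alpha>} * \<rho> ^ multi_degree \<alpha>"
      using \<rho> by (intro mult_right_mono) auto
  qed (use \<rho> in auto)
  moreover have "((\<lambda>\<alpha>. infsum c {i\<in>I. m i = \<alpha>} * multi_power u \<alpha>) has_sum f (x + u)) multi_indices"
    if "norm u \<le> \<rho>" for u
    by (rule has_sum_fibres[OF f[OF that] m c])
  ultimately show ?thesis using \<rho> by (simp add: expansion_at_def)
qed

lemma has_sum_prod_list:
  fixes g :: "'i \<Rightarrow> real"
  assumes g: "(g has_sum s) J"
  shows "((\<lambda>l. prod_list (map g l)) has_sum s ^ n) {l \<in> lists J. length l = n}"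
proof (induction n)
  case 0
  have "{l \<in> lists J. length l = 0} = {[]}" by auto
  thus ?case by (simp add: has_sum_finiteI)
next
  case (Suc n)
  let ?L = "{l \<in> lists J. length l = n}"
  have bij: "bij_betw (\<lambda>(i, l). i # l) (J \<times> ?L) {l \<in> lists J. length l = Suc n}"
    unfolding bij_betw_def by (auto simp: inj_on_def image_iff length_Suc_conv)
  have "((\<lambda>(i, l). g i * prod_list (map g l)) has_sum s * s ^ n) (J \<times> ?L)"
  proof (rule has_sum_SigmaI)
    show "((\<lambda>l. (case (i, l) of (i, l) \<Rightarrow> g i * prod_list (map g l))) has_sum g i * s ^ n) ?L" for i
      using has_sum_cmult_right[OF Suc, of "g i"] by simp
    show "((\<lambda>i. g i * s ^ n) has_sum s * s ^ n) J"
      using g by (rule has_sum_cmult_left)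
    have g': "(\<lambda>i. \<bar>g i\<bar>) summable_on J"
      and l': "(\<lambda>l. \<bar>prod_list (map g l)\<bar>) summable_on ?L"
      using has_sum_imp_summable[OF g] has_sum_imp_summable[OF Suc]
      by (simp_all add: summable_on_iff_abs_summable_on_real[of g]
            summable_on_iff_abs_summable_on_real[of "\<lambda>l. prod_list (map g l)"])
    have "(\<lambda>p. norm (case p of (i, l) \<Rightarrow> g i * prod_list (map g l))) summable_on (J \<times> ?L)"
    proof (rule summable_on_SigmaI)
      show "((\<lambda>l. norm (case (i, l) of (i, l) \<Rightarrow> g i * prod_list (map g l))) has_sum
          \<bar>g i\<bar> * infsum (\<lambda>l. \<bar>prod_list (map g l)\<bar>) ?L) ?L" for i
        using has_sum_cmult_right[OF has_sum_infsum[OF l'], of "\<bar>g i\<bar>"] by (simp add: abs_mult)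
      show "(\<lambda>i. \<bar>g i\<bar> * infsum (\<lambda>l. \<bar>prod_list (map g l)\<bar>) ?L) summable_on J"
        by (intro summable_on_cmult_left g')
    qed auto
    thus "(\<lambda>(i, l). g i * prod_list (map g l)) summable_on (J \<times> ?L)"
      by (rule abs_summable_summable)
  qed
  moreover have "prod_list (map g (case p of (i, l) \<Rightarrow> i # l)) =
      (case p of (i, l) \<Rightarrow> g i * prod_list (map g l))" for p
    by (cases p) simp
  ultimately have "((\<lambda>p. prod_list (map g (case p of (i, l) \<Rightarrow> i # l))) has_sum s ^ Suc n) (J \<times> ?L)"
    by simp
  thus ?case by (subst (asm) has_sum_reindex_bij_betw[OF bij])
qed

text \<open>
  A power series in a sum \<open>t = \<Sum> g\<^sub>i\<close>, multiplied out: the terms are indexed by the finite lists over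
  \<open>J\<close>, the lists of length \<open>n\<close> making up \<open>p\<^sub>n t\<^sup>n\<close>.
\<close>

lemma power_series_of_has_sum:
  fixes g G :: "'i \<Rightarrow> real"
  assumes g: "(g has_sum t) J" and G: "(G has_sum \<kappa>) J"
    and le: "\<And>i. i \<in> J \<Longrightarrow> \<bar>g i\<bar> \<le> G i"
    and p: "summable (\<lambda>n. \<bar>p n\<bar> * \<kappa> ^ n)" and v: "(\<lambda>n. p n * t ^ n) sums v"
  shows "(\<lambda>l. \<bar>p (length l)\<bar> * prod_list (map G l)) summable_on lists J"
    and "((\<lambda>l. p (length l) * prod_list (map g l)) has_sum v) (lists J)"
proof -
  let ?L = "\<lambda>n. {l \<in> lists J. length l = n}"
  have bij: "bij_betw snd (Sigma UNIV ?L) (lists J)"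
    unfolding bij_betw_def by (auto simp: inj_on_def image_iff)
  have G0: "G i \<ge> 0" if "i \<in> J" for i using le[OF that] by linarith
  have \<kappa>: "\<kappa> \<ge> 0" using has_sum_nonneg[OF G] G0 by simp
  have prod0: "prod_list (map G l) \<ge> 0" if "l \<in> lists J" for l
    using that by (induction l) (auto intro: mult_nonneg_nonneg G0)
  have "(\<lambda>p'. \<bar>p (length (snd p'))\<bar> * prod_list (map G (snd p'))) summable_on Sigma UNIV ?L"
  proof (rule summable_on_SigmaI)
    fix n
    have "((\<lambda>l. \<bar>p n\<bar> * prod_list (map G l)) has_sum \<bar>p n\<bar> * \<kappa> ^ n) (?L n)"
      by (intro has_sum_cmult_right has_sum_prod_list G)
    thus "((\<lambda>l. \<bar>p (length (snd (n, l)))\<bar> * prod_list (map G (snd (n, l)))) has_sum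
        \<bar>p n\<bar> * \<kappa> ^ n) (?L n)"
      by (rule has_sum_cong[THEN iffD1, rotated]) auto
  next
    show "(\<lambda>n. \<bar>p n\<bar> * \<kappa> ^ n) summable_on UNIV"
      using p \<kappa> by (subst summable_on_UNIV_nonneg_real_iff) auto
  qed (auto intro!: mult_nonneg_nonneg prod0)
  thus sG: "(\<lambda>l. \<bar>p (length l)\<bar> * prod_list (map G l)) summable_on lists J"
    using summable_on_reindex_bij_betw[OF bij, of "\<lambda>l. \<bar>p (length l)\<bar> * prod_list (map G l)"]
    by simp
  have prod_le: "\<bar>prod_list (map g l)\<bar> \<le> prod_list (map G l)" if "l \<in> lists J" for l
    using that by (induction l) (auto simp: abs_mult intro!: mult_mono le G0 prod0)
  have "(\<lambda>l. norm (p (length l) * prod_list (map g l))) summable_on lists J"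
    using sG
    by (rule summable_on_comparison_test) (auto simp: abs_mult intro!: mult_left_mono prod_le)
  hence "(\<lambda>l. p (length l) * prod_list (map g l)) summable_on lists J"
    by (rule abs_summable_summable)
  then obtain S where S: "((\<lambda>l. p (length l) * prod_list (map g l)) has_sum S) (lists J)"
    by (auto simp: summable_on_def)
  have "((\<lambda>n. p n * t ^ n) has_sum S) UNIV"
  proof (rule has_sum_SigmaD)
    show "((\<lambda>p'. p (length (snd p')) * prod_list (map g (snd p'))) has_sum S) (Sigma UNIV ?L)"
      using S by (subst has_sum_reindex_bij_betw[OF bij])
    fix n
    have "((\<lambda>l. p n * prod_list (map g l)) has_sum p n * t ^ n) (?L n)"
      by (intro has_sum_cmult_right has_sum_prod_list g)
    thus "((\<lambda>l. p (length (snd (n, l))) * prod_list (map g (snd (n, l)))) has_sum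
        p n * t ^ n) (?L n)"
      by (rule has_sum_cong[THEN iffD1, rotated]) auto
  qed
  hence "S = v" using v by (meson has_sum_imp_sums sums_unique2)
  with S show "((\<lambda>l. p (length l) * prod_list (map g l)) has_sum v) (lists J)" by simp
qed

text \<open>
  Composition with a one-variable power series. The expansion of \<open>f - f x\<close> has no constant term, so its
  majorant becomes smaller than the radius of convergence of the outer series once the polydisc is
  shrunk; the composed series is then indexed by lists of nonzero multi-indices.
\<close>

lemma expansion_at_compose:
  fixes f :: "'a::euclidean_space \<Rightarrow> real"
  assumes e: "expansion_at f x A \<rho>" and R: "R > 0"
    and p: "\<And>t. \<bar>t\<bar> < R \<Longrightarrow> (\<lambda>n. p n * t ^ n) sums \<phi> (f x + t)"
  shows "\<exists>B \<sigma>. expansion_at (\<lambda>y. \<phi> (f y)) x B \<sigma>"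
proof -
  let ?J = "multi_indices - {(\<lambda>_. 0) :: 'a \<Rightarrow> nat}"
  define K where "K = infsum (\<lambda>\<alpha>. \<bar>A \<alpha>\<bar> * \<rho> ^ multi_degree \<alpha>) ?J"
  have \<rho>: "\<rho> > 0" using e by (simp add: expansion_at_def)
  have K: "((\<lambda>\<alpha>. \<bar>A \<alpha>\<bar> * \<rho> ^ multi_degree \<alpha>) has_sum K) ?J"
    unfolding K_def using e
    by (intro has_sum_infsum) (auto simp: expansion_at_def intro: summable_on_subset_banach)
  have K0: "K \<ge> 0" using has_sum_nonneg[OF K] \<rho> by simp
  \<comment> \<open>a scaling factor for the polydisc, chosen so that \<open>s * K < R\<close>\<close>
  define s where "s = min 1 (R / (2 * (K + 1)))"
  have s: "0 < s" "s \<le> 1" using R K0 by (auto simp: s_def)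
  have sK: "s * K < R"
  proof -
    have "s * K \<le> R / (2 * (K + 1)) * K" unfolding s_def using K0 by (intro mult_right_mono) auto
    also have "\<dots> < R" using R K0 by (simp add: field_simps) (smt (verit) mult_nonneg_nonneg)
    finally show ?thesis .
  qed
  define \<sigma> where "\<sigma> = s * \<rho>"
  have \<sigma>: "0 < \<sigma>" "\<sigma> \<le> \<rho>" using s \<rho> by (auto simp: \<sigma>_def mult_left_le_one_le)
  have e': "expansion_at f x A \<sigma>" using expansion_at_shrink[OF e \<sigma>] .
  define G where "G \<alpha> = \<bar>A \<alpha>\<bar> * \<sigma> ^ multi_degree \<alpha>" for \<alpha>
  define \<kappa> where "\<kappa> = infsum G ?J"
  have G: "(G has_sum \<kappa>) ?J"
    unfolding \<kappa>_def G_def using e'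
    by (intro has_sum_infsum) (auto simp: expansion_at_def intro: summable_on_subset_banach)
  have "\<kappa> \<le> s * K"
  proof (rule has_sum_mono[OF G has_sum_cmult_right[OF K]])
    fix \<alpha> assume "\<alpha> \<in> ?J"
    then obtain d where d: "multi_degree \<alpha> = Suc d" by (rule multi_degree_pos)
    have "s ^ d \<le> 1" using s by (simp add: power_le_one)
    hence "s ^ multi_degree \<alpha> \<le> s" using s by (simp add: d mult_left_le)
    hence "s ^ multi_degree \<alpha> * (\<bar>A \<alpha>\<bar> * \<rho> ^ multi_degree \<alpha>) \<le> s * (\<bar>A \<alpha>\<bar> * \<rho> ^ multi_degree \<alpha>)"
      using \<rho> by (intro mult_right_mono) auto
    thus "G \<alpha> \<le> s * (\<bar>A \<alpha>\<bar> * \<rho> ^ multi_degree \<alpha>)"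
      by (simp add: G_def \<sigma>_def power_mult_distrib mult_ac)
  qed
  hence \<kappa>: "\<kappa> < R" using sK by simp
  have \<kappa>0: "\<kappa> \<ge> 0" using has_sum_nonneg[OF G] \<sigma> by (simp add: G_def)
  have sum_\<kappa>: "summable (\<lambda>n. \<bar>p n\<bar> * \<kappa> ^ n)"
  proof -
    have "summable (\<lambda>n. p n * ((\<kappa> + R) / 2) ^ n)"
      using p[of "(\<kappa> + R) / 2"] \<kappa> \<kappa>0 by (auto simp: sums_iff)
    hence "summable (\<lambda>n. norm (p n * \<kappa> ^ n))"
      using \<kappa> \<kappa>0 by (intro powser_insidea) auto
    thus ?thesis using \<kappa>0 by (simp add: abs_mult)
  qed
  define m :: "('a \<Rightarrow> nat) list \<Rightarrow> 'a \<Rightarrow> nat" where "m l = (\<lambda>b. sum_list (map (\<lambda>\<alpha>. \<alpha> b) l))" for l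
  define c where "c l = p (length l) * prod_list (map A l)" for l
  have m_pow: "multi_power u (m l) = prod_list (map (multi_power u) l)" for u l
    by (induction l) (simp_all add: m_def multi_power_zero multi_power_add)
  have m_deg: "\<sigma> ^ multi_degree (m l) = prod_list (map (\<lambda>\<alpha>. \<sigma> ^ multi_degree \<alpha>) l)" for l
    by (induction l) (simp_all add: m_def multi_degree_add power_add, simp add: multi_degree_def)
  have prod_mult: "prod_list (map f l) * prod_list (map g l) = prod_list (map (\<lambda>\<alpha>. f \<alpha> * g \<alpha>) l)"
    for f g :: "('a \<Rightarrow> nat) \<Rightarrow> real" and l
    by (induction l) (simp_all add: mult_ac)
  have prod_abs: "\<bar>prod_list (map A l)\<bar> = prod_list (map (\<lambda>\<alpha>. \<bar>A \<alpha>\<bar>) l)" for l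
    by (induction l) (simp_all add: abs_mult)
  have le: "\<bar>A \<alpha> * multi_power u \<alpha>\<bar> \<le> G \<alpha>" if "norm u \<le> \<sigma>" for u \<alpha>
    unfolding G_def abs_mult using abs_multi_power_le'[OF that] by (intro mult_left_mono) auto
  have ps: "(\<lambda>l. \<bar>p (length l)\<bar> * prod_list (map G l)) summable_on lists ?J"
      "((\<lambda>l. p (length l) * prod_list (map (\<lambda>\<alpha>. A \<alpha> * multi_power u \<alpha>) l)) has_sum
         \<phi> (f x + (f (x + u) - f x))) (lists ?J)"
    if u: "norm u \<le> \<sigma>" for u
  proof -
    note inc = expansion_at_increment[OF e' u]
    have "\<bar>f (x + u) - f x\<bar> \<le> \<kappa>"
      using norm_infsum_le[OF inc G] le[OF u] by simp
    hence sums: "(\<lambda>n. p n * (f (x + u) - f x) ^ n) sums \<phi> (f x + (f (x + u) - f x))"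
      using \<kappa> by (intro p) simp
    show "(\<lambda>l. \<bar>p (length l)\<bar> * prod_list (map G l)) summable_on lists ?J"
      "((\<lambda>l. p (length l) * prod_list (map (\<lambda>\<alpha>. A \<alpha> * multi_power u \<alpha>) l)) has_sum
         \<phi> (f x + (f (x + u) - f x))) (lists ?J)"
      using power_series_of_has_sum[OF inc G le[OF u] sum_\<kappa> sums] by auto
  qed
  have "expansion_at (\<lambda>y. \<phi> (f y)) x (\<lambda>\<alpha>. infsum c {l \<in> lists ?J. m l = \<alpha>}) \<sigma>"
  proof (rule expansion_at_regroup)
    show "\<sigma> > 0" by fact
    show "m l \<in> multi_indices" if "l \<in> lists ?J" for l
      using that by (induction l) (auto simp: m_def multi_indices_def)
    show "(\<lambda>l. \<bar>c l\<bar> * \<sigma> ^ multi_degree (m l)) summable_on lists ?J"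
      using ps(1)[of 0] \<sigma> by (simp add: c_def m_deg abs_mult prod_abs mult.assoc prod_mult G_def[abs_def])
    show "((\<lambda>l. c l * multi_power u (m l)) has_sum \<phi> (f (x + u))) (lists ?J)"
      if "norm u \<le> \<sigma>" for u
      using ps(2)[OF that] by (simp add: c_def m_pow mult.assoc prod_mult)
  qed
  thus ?thesis by blast
qed

section \<open>Logarithm and exponential of analytic functions\<close>

lemma real_analytic_on_ln:
  assumes f: "real_analytic_on f S" and pos: "\<And>x. x \<in> S \<Longrightarrow> f x > 0"
  shows "real_analytic_on (\<lambda>x. ln (f x)) S"
  unfolding real_analytic_on_iff_expansion
proof
  fix x assume x: "x \<in> S"
  with f obtain A \<rho> where e: "expansion_at f x A \<rho>"
    unfolding real_analytic_on_iff_expansion by blast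
  define a where "a = f x"
  have a: "a > 0" using pos[OF x] by (simp add: a_def)
  define p where "p n = (if n = 0 then ln a else 0) + - ((- (1 / a)) ^ n) / real n" for n
  show "\<exists>A \<rho>. expansion_at (\<lambda>x. ln (f x)) x A \<rho>"
  proof (rule expansion_at_compose[OF e a, of p])
    fix t assume t: "\<bar>t\<bar> < a"
    have "(\<lambda>n. (if n = 0 then ln a * t ^ n else 0) + - ((- (t / a)) ^ n) / real n) sums
        (ln a * t ^ 0 + ln (1 + t / a))"
      using t a by (intro sums_add sums_single ln_series') simp
    moreover have "(if n = 0 then ln a * t ^ n else 0) + - ((- (t / a)) ^ n) / real n = p n * t ^ n" for n
    proof -
      have "- (t / a) = - (1 / a) * t" by simp
      thus ?thesis by (simp only: p_def power_mult_distrib) (simp add: algebra_simps)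
    qed
    moreover have "ln a * t ^ 0 + ln (1 + t / a) = ln (f x + t)"
    proof -
      have "a + t = a * (1 + t / a)" "1 + t / a > 0" using a t by (auto simp: field_simps)
      thus ?thesis using a ln_mult_pos[of a "1 + t / a"] by (simp add: a_def)
    qed
    ultimately show "(\<lambda>n. p n * t ^ n) sums ln (f x + t)" by simp
  qed
qed

lemma real_analytic_on_exp:
  assumes f: "real_analytic_on f S"
  shows "real_analytic_on (\<lambda>x. exp (f x)) S"
  unfolding real_analytic_on_iff_expansion
proof
  fix x assume x: "x \<in> S"
  with f obtain A \<rho> where e: "expansion_at f x A \<rho>"
    unfolding real_analytic_on_iff_expansion by blast
  show "\<exists>A \<rho>. expansion_at (\<lambda>x. exp (f x)) x A \<rho>"
  proof (rule expansion_at_compose[OF e zero_less_one, of "\<lambda>n. exp (f x) * inverse (fact n)"])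
    fix t :: real
    show "(\<lambda>n. exp (f x) * inverse (fact n) * t ^ n) sums exp (f x + t)"
      using sums_mult[OF exp_converges[of t], of "exp (f x)"] by (simp add: exp_add mult_ac)
  qed
qed

section \<open>Power series in one variable\<close>

lemma real_analytic_on_power_series:
  fixes f :: "real \<Rightarrow> real"
  assumes "real_analytic_on f S" "x \<in> S"
  obtains r b where "r > 0" "\<And>t. \<bar>t\<bar> < r \<Longrightarrow> (\<lambda>n. b n * t ^ n) sums f (x + t)"
proof -
  obtain r A where r: "r > 0" and A: "\<And>y. y \<in> ball x r \<Longrightarrow>
      ((\<lambda>\<alpha>. A \<alpha> * (\<Prod>b\<in>Basis. ((y - x) \<bullet> b) ^ \<alpha> b)) has_sum f y) multi_indices"
    using assms unfolding real_analytic_on_def by blast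
  define e :: "nat \<Rightarrow> real \<Rightarrow> nat" where "e n = (\<lambda>s. if s = 1 then n else 0)" for n
  have bij: "bij_betw e UNIV multi_indices"
  proof (rule bij_betw_byWitness[where f' = "\<lambda>\<alpha>. \<alpha> 1"])
    show "\<forall>\<alpha>\<in>multi_indices. e (\<alpha> 1) = \<alpha>" by (auto simp: e_def multi_indices_def)
  qed (auto simp: e_def multi_indices_def)
  show thesis
  proof (rule that[OF r])
    fix t assume "\<bar>t\<bar> < r"
    hence "((\<lambda>\<alpha>. A \<alpha> * (\<Prod>b\<in>Basis. (((x + t) - x) \<bullet> b) ^ \<alpha> b)) has_sum f (x + t)) multi_indices"
      by (intro A) (simp add: dist_norm)
    hence "((\<lambda>n. A (e n) * (\<Prod>b\<in>Basis. (((x + t) - x) \<bullet> b) ^ e n b)) has_sum f (x + t)) UNIV"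
      by (subst (asm) has_sum_reindex_bij_betw[OF bij, symmetric])
    hence "((\<lambda>n. A (e n) * t ^ n) has_sum f (x + t)) UNIV"
      by (simp add: e_def)
    thus "(\<lambda>n. A (e n) * t ^ n) sums f (x + t)"
      by (rule has_sum_imp_sums)
  qed
qed

lemma power_series_has_derivative:
  fixes f :: "real \<Rightarrow> real"
  assumes f: "\<And>t. \<bar>t\<bar> < r \<Longrightarrow> (\<lambda>n. b n * t ^ n) sums f (x + t)" and t: "\<bar>t\<bar> < r"
  shows "(f has_real_derivative deriv f (x + t)) (at (x + t))"
    and "(\<lambda>n. diffs b n * t ^ n) sums deriv f (x + t)"
proof -
  have sm: "summable (\<lambda>n. b n * s ^ n)" if "norm s < r" for s
    using f[of s] that by (auto simp: sums_iff)
  have "((\<lambda>s. \<Sum>n. b n * s ^ n) has_real_derivative (\<Sum>n. diffs b n * t ^ n)) (at t)"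
    using termdiffs_strong'[OF sm] t by simp
  hence "((\<lambda>s. f (s + x)) has_real_derivative (\<Sum>n. diffs b n * t ^ n)) (at t)"
  proof (rule has_field_derivative_transform_within_open[where S = "ball 0 r"])
    fix s :: real assume "s \<in> ball 0 r"
    hence "\<bar>s\<bar> < r" by (simp add: dist_norm)
    from f[OF this] show "(\<Sum>n. b n * s ^ n) = f (s + x)" by (simp add: sums_iff add.commute)
  qed (use t in \<open>auto simp: dist_norm\<close>)
  hence D: "(f has_real_derivative (\<Sum>n. diffs b n * t ^ n)) (at (x + t))"
    by (simp add: DERIV_shift add.commute)
  hence d: "deriv f (x + t) = (\<Sum>n. diffs b n * t ^ n)" by (rule DERIV_imp_deriv)
  with D show "(f has_real_derivative deriv f (x + t)) (at (x + t))" by simp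
  have "summable (\<lambda>n. diffs b n * t ^ n)"
    by (rule termdiff_converges[of _ r]) (use t sm in auto)
  thus "(\<lambda>n. diffs b n * t ^ n) sums deriv f (x + t)"
    unfolding d by (rule summable_sums)
qed

lemma real_analytic_on_has_derivative:
  assumes "real_analytic_on f S" "x \<in> S"
  shows "(f has_real_derivative deriv f x) (at x)"
proof -
  obtain r b where "r > 0" and "\<And>t. \<bar>t\<bar> < r \<Longrightarrow> (\<lambda>n. b n * t ^ n) sums f (x + t)"
    using real_analytic_on_power_series[OF assms] by blast
  thus ?thesis using power_series_has_derivative(1)[of r b f x 0] by simp
qed

lemma higher_deriv_power_series:
  fixes f :: "real \<Rightarrow> real"
  assumes r: "r > 0" and f: "\<And>t. \<bar>t\<bar> < r \<Longrightarrow> (\<lambda>n. b n * t ^ n) sums f t"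
  shows "(deriv ^^ n) f 0 = fact n * b n"
  using f
proof (induction n arbitrary: f b)
  case 0
  have "(\<lambda>n. b n * 0 ^ n) sums f 0" using r by (intro "0.prems") simp
  thus ?case using sums_unique2 powser_sums_zero[of b] by fastforce
next
  case (Suc n)
  have "(\<lambda>n. diffs b n * t ^ n) sums deriv f t" if "\<bar>t\<bar> < r" for t
    using power_series_has_derivative(2)[of r b f 0 t] Suc.prems that by simp
  from Suc.IH[OF this] have "(deriv ^^ n) (deriv f) 0 = fact n * diffs b n" by simp
  thus ?case by (simp add: funpow_swap1 diffs_def)
qed

text \<open>
  Both \<open>f(t)\<close> and \<open>- f(- t)\<close> expand into power series, whose coefficients agree by uniqueness.
\<close>

lemma odd_power_series_even_coeff:
  fixes f :: "real \<Rightarrow> real"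
  assumes r: "r > 0" and f: "\<And>t. \<bar>t\<bar> < r \<Longrightarrow> (\<lambda>n. b n * t ^ n) sums f t"
    and odd: "\<And>t. f (- t) = - f t" and n: "even n"
  shows "b n = 0"
proof -
  have "(\<lambda>n. - ((-1) ^ n * b n) * t ^ n) sums f t" if "\<bar>t\<bar> < r" for t
  proof -
    have "(\<lambda>n. - (b n * (- t) ^ n)) sums - f (- t)"
      using f[of "- t"] that by (intro sums_minus) simp
    moreover have "- (b n * (- t) ^ n) = - ((-1) ^ n * b n) * t ^ n" for n
      by (subst power_minus) (simp add: mult_ac)
    ultimately show ?thesis by (simp add: odd)
  qed
  from higher_deriv_power_series[OF r this, where n = n] higher_deriv_power_series[OF r f, where n = n]
  show ?thesis using n by simp
qed

text \<open>
  Taylor expansion of an odd analytic function, and its leading correction to the linear term.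
\<close>

lemma odd_analytic_Taylor:
  fixes D :: "real \<Rightarrow> real"
  assumes an: "real_analytic_on D UNIV" and odd: "\<And>y. D (- y) = - D y"
  defines "c \<equiv> \<lambda>j. (deriv ^^ (2 * j + 1)) D 0 / fact (2 * j + 1)"
  shows "\<forall>\<^sub>F y in nhds 0. (\<lambda>j. c (Suc j) * y ^ (2 * Suc j + 1)) sums (D y - deriv D 0 * y)"
    and "1 \<le> k \<Longrightarrow> (\<And>i. 1 \<le> i \<Longrightarrow> i < k \<Longrightarrow> c i = 0) \<Longrightarrow>
      ((\<lambda>y. (deriv D 0 - D y / y) / y ^ (2 * k)) \<longlongrightarrow> - c k) (at 0)"
proof -
  obtain r b where r: "r > 0" and "\<And>t. \<bar>t\<bar> < r \<Longrightarrow> (\<lambda>n. b n * t ^ n) sums D (0 + t)"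
    using real_analytic_on_power_series[OF an, of 0] by blast
  hence f: "(\<lambda>n. b n * t ^ n) sums D t" if "\<bar>t\<bar> < r" for t using that by simp
  have b: "(deriv ^^ n) D 0 = fact n * b n" for n
    by (rule higher_deriv_power_series[OF r f])
  have b_even: "b n = 0" if "even n" for n
    by (rule odd_power_series_even_coeff[OF r f odd that])
  have b1: "b 1 = deriv D 0" using b[of 1] by simp
  have c: "c j = b (2 * j + 1)" for j unfolding c_def b by (simp del: fact_Suc)
  have odd_sums: "(\<lambda>j. c j * y ^ (2 * j + 1)) sums D y" if y: "\<bar>y\<bar> < r" for y
  proof -
    have mono: "strict_mono (\<lambda>j::nat. 2 * j + 1)" by (simp add: strict_mono_def)
    have "b n * y ^ n = 0" if "n \<notin> range (\<lambda>j::nat. 2 * j + 1)" for n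
    proof -
      have "even n" using that by (metis oddE rangeI)
      thus ?thesis by (simp add: b_even)
    qed
    from sums_mono_reindex[of "\<lambda>j. 2 * j + 1" "\<lambda>n. b n * y ^ n", OF mono this] f[OF y]
    show ?thesis by (simp add: c)
  qed
  show "\<forall>\<^sub>F y in nhds 0. (\<lambda>j. c (Suc j) * y ^ (2 * Suc j + 1)) sums (D y - deriv D 0 * y)"
    unfolding eventually_nhds_metric
  proof (intro exI[of _ r] conjI allI impI r)
    fix y :: real assume "dist y 0 < r"
    hence "(\<lambda>j. c j * y ^ (2 * j + 1)) sums D y" by (intro odd_sums) simp
    from sums_split_initial_segment[OF this, of 1]
    show "(\<lambda>j. c (Suc j) * y ^ (2 * Suc j + 1)) sums (D y - deriv D 0 * y)"
      by (simp add: c b1[simplified])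
  qed
  show "((\<lambda>y. (deriv D 0 - D y / y) / y ^ (2 * k)) \<longlongrightarrow> - c k) (at 0)"
    if k: "1 \<le> k" and z: "\<And>i. 1 \<le> i \<Longrightarrow> i < k \<Longrightarrow> c i = 0"
  proof -
    have b0: "b n = 0" if "n < 2 * k + 1" "n \<noteq> 1" for n
    proof (cases "even n")
      case False
      then obtain j where "n = 2 * j + 1" by (rule oddE)
      with z[of j] that show ?thesis by (simp add: c)
    qed (rule b_even)
    have "((\<lambda>y. (deriv D 0 - D y / y) / y ^ (2 * k)) \<longlongrightarrow> - b (0 + (2 * k + 1))) (at 0)"
    proof (rule powser_limit_0_strong[OF r])
      fix y :: real assume y: "y \<noteq> 0" "norm y < r"
      have "(\<Sum>i<2 * k + 1. b i * y ^ i) = (\<Sum>i\<in>{1}. b i * y ^ i)"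
        using k b0 by (intro sum.mono_neutral_right) auto
      with sums_split_initial_segment[OF f[of y], of "2 * k + 1"] y
      have "(\<lambda>i. b (i + (2 * k + 1)) * y ^ (i + (2 * k + 1))) sums (D y - deriv D 0 * y)"
        by (simp add: b1[simplified])
      from sums_mult[OF this, of "- (1 / y ^ (2 * k + 1))"]
      have "(\<lambda>i. - (1 / y ^ (2 * k + 1)) * (b (i + (2 * k + 1)) * y ^ (i + (2 * k + 1)))) sums
          (- (1 / y ^ (2 * k + 1)) * (D y - deriv D 0 * y))" .
      moreover have "- (1 / y ^ (2 * k + 1)) * (b (i + (2 * k + 1)) * y ^ (i + (2 * k + 1))) =
          - b (i + (2 * k + 1)) * y ^ i" for i
        using y by (simp only: power_add[of y i]) simp
      moreover have "- (1 / y ^ (2 * k + 1)) * (D y - deriv D 0 * y) =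
          (deriv D 0 - D y / y) / y ^ (2 * k)"
        using y by (simp add: field_simps)
      ultimately show "(\<lambda>i. - b (i + (2 * k + 1)) * y ^ i) sums ((deriv D 0 - D y / y) / y ^ (2 * k))"
        by simp
    qed
    thus ?thesis by (simp add: c)
  qed
qed

section \<open>Taylor coefficients of analytic families\<close>

text \<open>
  Sorting the joint expansion by the exponent \<open>n\<close> of \<open>y\<close> exhibits the \<open>n\<close>-th Taylor coefficient in \<open>y\<close>
  as a series in the remaining variables. Halving the radius keeps the point \<open>(u, y)\<close> inside the ball.
\<close>

lemma real_analytic_on_coefficient:
  fixes P :: "'a::euclidean_space \<Rightarrow> real \<Rightarrow> real"
  assumes P: "real_analytic_on (\<lambda>(\<theta>, y). P \<theta> y) U" and U: "\<Theta> \<times> {0} \<subseteq> U"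
  shows "real_analytic_on (\<lambda>\<theta>. (deriv ^^ n) (P \<theta>) 0) \<Theta>"
  unfolding real_analytic_on_iff_expansion
proof
  fix \<theta> assume "\<theta> \<in> \<Theta>"
  with U have "(\<theta>, 0) \<in> U" by auto
  with P obtain A \<rho> where e: "expansion_at (\<lambda>(\<theta>, y). P \<theta> y) (\<theta>, 0) A \<rho>"
    unfolding real_analytic_on_iff_expansion by blast
  define \<sigma> where "\<sigma> = \<rho> / 2"
  have \<rho>: "\<rho> > 0" using e by (simp add: expansion_at_def)
  have \<sigma>: "\<sigma> > 0" using \<rho> by (simp add: \<sigma>_def)
  define m :: "('a \<times> real \<Rightarrow> nat) \<Rightarrow> 'a \<Rightarrow> nat" where "m \<alpha> = (\<lambda>b. \<alpha> (b, 0))" for \<alpha>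
  define I :: "nat \<Rightarrow> ('a \<times> real \<Rightarrow> nat) set" where "I n = {\<alpha> \<in> multi_indices. \<alpha> (0, 1) = n}" for n
  have split_prod: "(\<Prod>b\<in>Basis. h b) = (\<Prod>b\<in>Basis. h (b, 0)) * h (0, 1)"
    for h :: "'a \<times> real \<Rightarrow> real"
    unfolding Basis_prod_def
    by (subst prod.union_disjoint) (auto simp: prod.reindex inj_on_def)
  have split_sum: "(\<Sum>b\<in>Basis. h b) = (\<Sum>b\<in>Basis. h (b, 0)) + h (0, 1)"
    for h :: "'a \<times> real \<Rightarrow> nat"
    unfolding Basis_prod_def
    by (subst sum.union_disjoint) (auto simp: sum.reindex inj_on_def)
  have pow: "multi_power (u, y) \<alpha> = multi_power u (m \<alpha>) * y ^ \<alpha> (0, 1)" for u y \<alpha>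
    unfolding multi_power_def m_def by (subst split_prod) simp
  have deg: "multi_degree \<alpha> = multi_degree (m \<alpha>) + \<alpha> (0, 1)" for \<alpha>
    unfolding multi_degree_def m_def by (rule split_sum)
  have e': "expansion_at (\<lambda>(\<theta>, y). P \<theta> y) (\<theta>, 0) A \<sigma>"
    using expansion_at_shrink[OF e \<sigma>] \<rho> by (simp add: \<sigma>_def)
  have sI: "(\<lambda>\<alpha>. \<bar>A \<alpha>\<bar> * \<sigma> ^ multi_degree (m \<alpha>)) summable_on I n" for n
  proof -
    have "(\<lambda>\<alpha>. \<bar>A \<alpha>\<bar> * \<sigma> ^ multi_degree \<alpha>) summable_on I n"
      using e' by (auto simp: expansion_at_def I_def intro: summable_on_subset_banach)
    also have "?this \<longleftrightarrow> (\<lambda>\<alpha>. \<bar>A \<alpha>\<bar> * \<sigma> ^ multi_degree (m \<alpha>) * \<sigma> ^ n) summable_on I n"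
      by (intro summable_on_cong) (auto simp: deg power_add I_def)
    finally show ?thesis using \<sigma> by (subst (asm) summable_on_cmult_left') auto
  qed
  define B where "B n u = infsum (\<lambda>\<alpha>. A \<alpha> * multi_power u (m \<alpha>)) (I n)" for n u
  have B: "((\<lambda>\<alpha>. A \<alpha> * multi_power u (m \<alpha>)) has_sum B n u) (I n)" if u: "norm u \<le> \<sigma>" for u n
    unfolding B_def
  proof (rule has_sum_infsum, rule abs_summable_summable)
    show "(\<lambda>\<alpha>. norm (A \<alpha> * multi_power u (m \<alpha>))) summable_on I n"
      using sI[of n]
    proof (rule summable_on_comparison_test)
      fix \<alpha>
      show "norm (A \<alpha> * multi_power u (m \<alpha>)) \<le> \<bar>A \<alpha>\<bar> * \<sigma> ^ multi_degree (m \<alpha>)"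
        unfolding real_norm_def abs_mult
        by (intro mult_left_mono abs_multi_power_le'[OF u] abs_ge_zero)
    qed simp
  qed
  have series: "(\<lambda>n. B n u * y ^ n) sums P (\<theta> + u) y" if u: "norm u \<le> \<sigma>" and y: "\<bar>y\<bar> < \<sigma>" for u y
  proof -
    have bij: "bij_betw snd (Sigma UNIV I) multi_indices"
      by (rule bij_betw_byWitness[where f' = "\<lambda>\<alpha>. (\<alpha> (0, 1), \<alpha>)"]) (auto simp: I_def)
    have "norm (u, y) \<le> \<rho>"
      using norm_Pair_le[of u y] u y by (simp add: \<sigma>_def)
    with e have "((\<lambda>\<alpha>. A \<alpha> * multi_power (u, y) \<alpha>) has_sum
        (case (\<theta>, 0) + (u, y) of (\<theta>, y) \<Rightarrow> P \<theta> y)) multi_indices"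
      unfolding expansion_at_def by blast
    hence *: "((\<lambda>\<alpha>. A \<alpha> * multi_power (u, y) \<alpha>) has_sum P (\<theta> + u) y) multi_indices"
      by simp
    have "((\<lambda>n. B n u * y ^ n) has_sum P (\<theta> + u) y) UNIV"
    proof (rule has_sum_SigmaD)
      show "((\<lambda>p. A (snd p) * multi_power (u, y) (snd p)) has_sum P (\<theta> + u) y) (Sigma UNIV I)"
        using * by (subst has_sum_reindex_bij_betw[OF bij])
      fix n
      have "((\<lambda>\<alpha>. A \<alpha> * multi_power u (m \<alpha>) * y ^ n) has_sum B n u * y ^ n) (I n)"
        by (rule has_sum_cmult_left[OF B[OF u]])
      thus "((\<lambda>\<alpha>. A (snd (n, \<alpha>)) * multi_power (u, y) (snd (n, \<alpha>))) has_sum B n u * y ^ n) (I n)"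
        by (rule has_sum_cong[THEN iffD1, rotated]) (auto simp: pow I_def)
    qed
    thus ?thesis by (rule has_sum_imp_sums)
  qed
  have coeff: "(deriv ^^ n) (P (\<theta> + u)) 0 = fact n * B n u" if "norm u \<le> \<sigma>" for u
    by (rule higher_deriv_power_series[OF \<sigma> series[OF that]])
  have "expansion_at (\<lambda>\<theta>. (deriv ^^ n) (P \<theta>) 0) \<theta>
      (\<lambda>\<alpha>. infsum (\<lambda>\<alpha>. fact n * A \<alpha>) {i \<in> I n. m i = \<alpha>}) \<sigma>"
  proof (rule expansion_at_regroup)
    show "\<sigma> > 0" by fact
    show "m \<alpha> \<in> multi_indices" if "\<alpha> \<in> I n" for \<alpha>
    proof -
      have "(b, 0 :: real) \<notin> Basis" if "b \<notin> Basis" for b :: 'a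
        using that by (auto simp: Basis_prod_def)
      thus ?thesis using that by (simp add: I_def m_def multi_indices_def)
    qed
    show "(\<lambda>\<alpha>. \<bar>fact n * A \<alpha>\<bar> * \<sigma> ^ multi_degree (m \<alpha>)) summable_on I n"
      using summable_on_cmult_right[OF sI[of n], of "fact n"] by (simp add: abs_mult mult.assoc)
    show "((\<lambda>\<alpha>. fact n * A \<alpha> * multi_power u (m \<alpha>)) has_sum (deriv ^^ n) (P (\<theta> + u)) 0) (I n)"
      if "norm u \<le> \<sigma>" for u
      unfolding coeff[OF that] mult.assoc by (intro has_sum_cmult_right B that)
  qed
  thus "\<exists>A \<rho>. expansion_at (\<lambda>\<theta>. (deriv ^^ n) (P \<theta>) 0) \<theta> A \<rho>" by blast
qed

text \<open>
  Openness matters here: an expansion at a point of \<open>S\<close> involves the values of the function on a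
  neighbourhood of that point.
\<close>

lemma real_analytic_on_cong_open:
  assumes f: "real_analytic_on f S" and S: "open S" and eq: "\<And>x. x \<in> S \<Longrightarrow> f x = g x"
  shows "real_analytic_on g S"
  unfolding real_analytic_on_iff_expansion
proof
  fix x assume x: "x \<in> S"
  with f obtain A \<rho> where e: "expansion_at f x A \<rho>"
    unfolding real_analytic_on_iff_expansion by blast
  obtain d where d: "d > 0" "cball x d \<subseteq> S" using S x open_contains_cball by blast
  have e': "expansion_at f x A (min d \<rho>)"
    using expansion_at_shrink[OF e, of "min d \<rho>"] d e by (simp add: expansion_at_def)
  have "f (x + u) = g (x + u)" if "norm u \<le> min d \<rho>" for u
    using d(2) that by (intro eq) (auto simp: dist_norm)
  hence "expansion_at g x A (min d \<rho>)" using e' by (auto simp: expansion_at_def)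
  thus "\<exists>A \<rho>. expansion_at g x A \<rho>" by blast
qed

lemma real_analytic_on_subset:
  "real_analytic_on f S \<Longrightarrow> S' \<subseteq> S \<Longrightarrow> real_analytic_on f S'"
  unfolding real_analytic_on_def by blast

lemma real_analytic_on_cmult:
  "real_analytic_on f S \<Longrightarrow> real_analytic_on (\<lambda>x. s * f x) S"
  using real_analytic_on_linear_combination[of f S f s 0] by simp

lemma real_analytic_on_imp_continuous_on:
  "real_analytic_on f S \<Longrightarrow> continuous_on S f"
  unfolding real_analytic_on_iff_expansion
  by (intro continuous_at_imp_continuous_on) (blast intro: expansion_at_isCont)

text \<open>
  Both functions are written on \<open>U\<close> through the logarithms of \<open>a\<close> and \<open>- c\<close>.
\<close>

lemma real_analytic_critical_parameters:
  fixes a c :: "'a::euclidean_space \<Rightarrow> real"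
  assumes a: "real_analytic_on a \<Theta>" and c: "real_analytic_on c \<Theta>" and \<Theta>: "open \<Theta>"
  defines "U \<equiv> {\<theta>\<in>\<Theta>. a \<theta> > 0 \<and> c \<theta> < 0}"
  shows "open U" and "real_analytic_on (\<lambda>\<theta>. 1 / a \<theta>) U"
    and "real_analytic_on (\<lambda>\<theta>. a \<theta> * ((a \<theta>)\<^sup>2 / (- c \<theta>)) powr s) U"
proof -
  have "open (\<Theta> \<inter> a -` {0<..})" "open (\<Theta> \<inter> c -` {..<0})"
    using a c \<Theta> by (auto intro!: continuous_open_preimage real_analytic_on_imp_continuous_on)
  moreover have "U = (\<Theta> \<inter> a -` {0<..}) \<inter> (\<Theta> \<inter> c -` {..<0})" by (auto simp: U_def)
  ultimately show U: "open U" by auto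
  have aU: "real_analytic_on a U" and cU: "real_analytic_on c U"
    using a c by (auto intro: real_analytic_on_subset simp: U_def)
  have ln_a: "real_analytic_on (\<lambda>\<theta>. ln (a \<theta>)) U"
    by (rule real_analytic_on_ln[OF aU]) (simp add: U_def)
  have ln_c: "real_analytic_on (\<lambda>\<theta>. ln (- c \<theta>)) U"
    using real_analytic_on_cmult[OF cU, of "-1"]
    by (intro real_analytic_on_ln) (simp_all add: U_def)
  show "real_analytic_on (\<lambda>\<theta>. 1 / a \<theta>) U"
  proof (rule real_analytic_on_cong_open[OF _ U])
    show "real_analytic_on (\<lambda>\<theta>. exp (-1 * ln (a \<theta>))) U"
      by (intro real_analytic_on_exp real_analytic_on_cmult ln_a)
    show "exp (-1 * ln (a \<theta>)) = 1 / a \<theta>" if "\<theta> \<in> U" for \<theta>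
      using that by (simp add: U_def exp_minus inverse_eq_divide)
  qed
  show "real_analytic_on (\<lambda>\<theta>. a \<theta> * ((a \<theta>)\<^sup>2 / (- c \<theta>)) powr s) U"
  proof (rule real_analytic_on_cong_open[OF _ U])
    show "real_analytic_on (\<lambda>\<theta>. exp ((1 + 2 * s) * ln (a \<theta>) + (- s) * ln (- c \<theta>))) U"
      by (intro real_analytic_on_exp real_analytic_on_linear_combination ln_a ln_c)
    fix \<theta> assume "\<theta> \<in> U"
    hence pos: "a \<theta> > 0" "- c \<theta> > 0" by (auto simp: U_def)
    have "ln ((a \<theta>)\<^sup>2 / (- c \<theta>)) = 2 * ln (a \<theta>) - ln (- c \<theta>)"
      using pos by (subst ln_divide_pos) (auto simp: ln_realpow)
    hence "((a \<theta>)\<^sup>2 / (- c \<theta>)) powr s = exp (s * (2 * ln (a \<theta>) - ln (- c \<theta>)))"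
      using pos by (auto simp: powr_def)
    moreover have "exp ((1 + 2 * s) * ln (a \<theta>) + (- s) * ln (- c \<theta>)) =
        exp (ln (a \<theta>)) * exp (s * (2 * ln (a \<theta>) - ln (- c \<theta>)))"
      by (simp add: exp_add[symmetric] algebra_simps)
    ultimately show "exp ((1 + 2 * s) * ln (a \<theta>) + (- s) * ln (- c \<theta>)) =
        a \<theta> * ((a \<theta>)\<^sup>2 / (- c \<theta>)) powr s"
      using pos by simp
  qed
qed

section \<open>Boundedness of rotation values\<close>

lemma bounded_on_graph:
  assumes X: "compact_space (mtopology_of X)" and T: "correspondence X T"
    and \<psi>: "continuous_map (graph_topology X T) euclideanreal \<psi>"
  obtains M where "M \<ge> 0" "\<And>w. w \<in> graph_of X T \<Longrightarrow> \<bar>\<psi> w\<bar> \<le> M"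
proof -
  have cl: "closedin (prod_topology (mtopology_of X) (mtopology_of X)) (graph_of X T)"
    using T by (simp add: correspondence_def)
  moreover have "compact_space (prod_topology (mtopology_of X) (mtopology_of X))"
    using X by (simp add: compact_space_prod_topology)
  ultimately have "compactin (prod_topology (mtopology_of X) (mtopology_of X)) (graph_of X T)"
    by (rule closedin_compact_space[rotated])
  hence "compactin (graph_topology X T) (graph_of X T)"
    unfolding graph_topology_def by (intro compact_imp_compactin_subtopology) auto
  hence "compact (\<psi> ` graph_of X T)"
    using image_compactin[OF _ \<psi>] by (simp add: compactin_euclidean_iff)
  hence "bounded (\<psi> ` graph_of X T)" by (rule compact_imp_bounded)
  then obtain B where "\<forall>w\<in>graph_of X T. \<bar>\<psi> w\<bar> \<le> B" by (auto simp: bounded_iff)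
  hence "\<bar>\<psi> w\<bar> \<le> max B 0" if "w \<in> graph_of X T" for w using that by fastforce
  thus thesis by (intro that[of "max B 0"]) auto
qed

text \<open>
  The bound holds whether or not the graph is measurable: the restriction of a measure to a
  nonmeasurable set assigns to each set either the original value or \<open>0\<close>.
\<close>

lemma emeasure_two_coord_le_1:
  assumes p: "p \<in> stationary_pairs X T"
  shows "emeasure (two_coord X T p) A \<le> 1"
proof -
  obtain \<mu> Q where pQ: "p = (\<mu>, Q)" by (cases p)
  let ?B = "mborel X"
  have \<mu>: "sets \<mu> = sets ?B" "prob_space \<mu>" and Q: "Q \<in> ?B \<rightarrow>\<^sub>M prob_algebra ?B"
    using p by (auto simp: pQ stationary_pairs_def transition_kernels_def space_prob_algebra)
  define N where "N = \<mu> \<bind> (\<lambda>x. distr (Q x) (?B \<Otimes>\<^sub>M ?B) (\<lambda>y. (x, y)))"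
  have "(\<lambda>x. distr (Q x) (?B \<Otimes>\<^sub>M ?B) (\<lambda>y. (x, y))) \<in> ?B \<rightarrow>\<^sub>M subprob_algebra (?B \<Otimes>\<^sub>M ?B)"
  proof (rule measurable_distr2)
    show "(\<lambda>(x, y). (x, y)) \<in> ?B \<Otimes>\<^sub>M ?B \<rightarrow>\<^sub>M ?B \<Otimes>\<^sub>M ?B" by simp
    show "Q \<in> ?B \<rightarrow>\<^sub>M subprob_algebra ?B" using Q by (rule measurable_prob_algebraD)
  qed
  hence "(\<lambda>x. distr (Q x) (?B \<Otimes>\<^sub>M ?B) (\<lambda>y. (x, y))) \<in> \<mu> \<rightarrow>\<^sub>M subprob_algebra (?B \<Otimes>\<^sub>M ?B)"
    by (subst measurable_cong_sets[OF \<mu>(1) refl])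
  hence "subprob_space N"
    unfolding N_def by (intro subprob_space_bind prob_space_imp_subprob_space \<mu>(2))
  hence "emeasure N B \<le> 1" for B
    by (rule subprob_space.subprob_emeasure_le_1)
  thus ?thesis
    by (simp add: two_coord_def pQ N_def[symmetric] restrict_space_def emeasure_measure_of_conv)
qed

text \<open>
  If \<open>\<psi>\<close> is not integrable then the rotation value is \<open>0\<close> by convention, so the bound holds in any case.
\<close>

lemma rotation_value_bounded:
  assumes X: "compact_space (mtopology_of X)" and T: "correspondence X T"
    and \<psi>: "continuous_map (graph_topology X T) euclideanreal \<psi>"
  obtains M where "\<And>p. p \<in> stationary_pairs X T \<Longrightarrow> \<bar>rotation_value X T \<psi> p\<bar> \<le> M"
proof -
  obtain M where M: "M \<ge> 0" "\<And>w. w \<in> graph_of X T \<Longrightarrow> \<bar>\<psi> w\<bar> \<le> M"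
    using bounded_on_graph[OF assms] by blast
  have "\<bar>rotation_value X T \<psi> p\<bar> \<le> M" if p: "p \<in> stationary_pairs X T" for p
  proof (cases "integrable (two_coord X T p) \<psi>")
    case True
    let ?\<gamma> = "two_coord X T p"
    have sub: "space ?\<gamma> \<subseteq> graph_of X T"
      by (cases p) (simp add: two_coord_def space_restrict_space)
    interpret finite_measure ?\<gamma>
    proof (rule finite_measureI)
      show "emeasure ?\<gamma> (space ?\<gamma>) \<noteq> \<infinity>"
        using emeasure_two_coord_le_1[OF p, of "space ?\<gamma>"] by (metis infinity_ennreal_def ennreal_one_less_top leD)
    qed
    have le1: "measure ?\<gamma> (space ?\<gamma>) \<le> 1"
      using emeasure_two_coord_le_1[OF p, of "space ?\<gamma>"] by (simp add: emeasure_eq_measure)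
    have "\<bar>rotation_value X T \<psi> p\<bar> \<le> (\<integral>w. \<bar>\<psi> w\<bar> \<partial>?\<gamma>)"
      unfolding rotation_value_def using integral_norm_bound[of ?\<gamma> \<psi>] by simp
    also have "\<dots> \<le> (\<integral>w. M \<partial>?\<gamma>)"
      using True sub M(2) by (intro integral_mono) auto
    also have "\<dots> = M * measure ?\<gamma> (space ?\<gamma>)" by simp
    also have "\<dots> \<le> M" using M(1) le1 by (simp add: mult_left_le)
    finally show ?thesis .
  next
    case False
    thus ?thesis using M(1) by (simp add: rotation_value_def not_integrable_integral_eq)
  qed
  thus thesis by (rule that)
qed

section \<open>Linear equilibrium pairs and the pressure\<close>

lemma convex_on_of_strictly_convex_on:
  assumes "strictly_convex_on S f"
  shows "convex_on S f"
  unfolding convex_on_alt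
proof (intro conjI ballI allI impI)
  show "convex S" using assms by (simp add: strictly_convex_on_def)
  fix x y \<mu> :: real assume *: "x \<in> S" "y \<in> S" "0 \<le> \<mu> \<and> \<mu> \<le> 1"
  show "f (\<mu> *\<^sub>R x + (1 - \<mu>) *\<^sub>R y) \<le> \<mu> * f x + (1 - \<mu>) * f y"
  proof (cases "x = y \<or> \<mu> = 0 \<or> \<mu> = 1")
    case True
    thus ?thesis by (auto simp: algebra_simps)
  next
    case False
    hence "f ((1 - (1 - \<mu>)) * x + (1 - \<mu>) * y) < (1 - (1 - \<mu>)) * f x + (1 - \<mu>) * f y"
      using assms[unfolded strictly_convex_on_def, THEN conjunct2, rule_format, of x y "1 - \<mu>"] *
      by linarith
    thus ?thesis by simp
  qed
qed

lemma deriv_eq_of_supporting_line: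
  fixes P :: "real \<Rightarrow> real"
  assumes D: "(P has_real_derivative d) (at y)"
    and line: "\<And>y'. P y - y * z \<le> P y' - y' * z"
  shows "d = z"
proof -
  have "((\<lambda>y. P y - y * z) has_real_derivative (d - z)) (at y)"
    using D by (auto intro!: derivative_eq_intros)
  hence "d - z = 0"
    by (rule DERIV_local_min[of _ _ _ 1]) (use line in auto)
  thus ?thesis by simp
qed

lemma kernel_entropy_le:
  assumes L: "legendre_assumptions X T \<psi>" and p: "p \<in> stationary_pairs X T"
  shows "kernel_entropy X p \<le> ereal (pressure_fun X T \<psi> y - y * rotation_value X T \<psi> p)"
proof -
  let ?z = "rotation_value X T \<psi> p"
  have "?z \<in> rotation_set X T \<psi>" using p by (simp add: rotation_set_def)
  hence "localized_entropy X T \<psi> ?z = (INF y. ereal (pressure_fun X T \<psi> y - y * ?z))"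
    using L by (simp add: legendre_assumptions_def Let_def)
  moreover have "kernel_entropy X p \<le> localized_entropy X T \<psi> ?z"
    unfolding localized_entropy_def using p by (intro SUP_upper) auto
  moreover have "(INF y. ereal (pressure_fun X T \<psi> y - y * ?z)) \<le>
      ereal (pressure_fun X T \<psi> y - y * ?z)"
    by (rule INF_lower) simp
  ultimately show ?thesis by simp
qed

text \<open>
  By the Legendre formula the maximum defining a linear equilibrium pair is \<open>P y\<close>. Equality in
  \<open>kernel_entropy_le\<close> makes the line of slope \<open>rotation_value p\<close> through \<open>(y, P y)\<close> a supporting line of
  \<open>P\<close>, which identifies the slope as the derivative.
\<close>

lemma linear_equilibrium_pair_attains:
  assumes L: "legendre_assumptions X T \<psi>"
    and p: "p \<in> linear_equilibrium_pairs X T (\<lambda>w. y * \<psi> w)"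
  shows "rotation_value X T \<psi> p = deriv (pressure_fun X T \<psi>) y"
    and "kernel_entropy X p =
      ereal (pressure_fun X T \<psi> y - y * deriv (pressure_fun X T \<psi>) y)"
proof -
  define P where "P = pressure_fun X T \<psi>"
  define R where "R = rotation_set X T \<psi>"
  let ?r = "rotation_value X T \<psi>"
  let ?S = "stationary_pairs X T"
  have analytic: "real_analytic_on P UNIV" and sc: "strictly_convex_on UNIV P"
    and range: "range (deriv P) = interior R"
    and h: "\<And>z. z \<in> R \<Longrightarrow> localized_entropy X T \<psi> z = (INF y. ereal (P y - y * z))"
    using L by (auto simp: legendre_assumptions_def Let_def P_def R_def homeomorphism_def)
  have D: "(P has_real_derivative deriv P y) (at y)" for y
    using real_analytic_on_has_derivative[OF analytic] by simp
  have tangent: "P y - y * deriv P y \<le> P y' - y' * deriv P y" for y'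
    using convex_on_imp_above_tangent[OF convex_on_of_strictly_convex_on[OF sc], of y y' "deriv P y"] D
    by (simp add: algebra_simps)
  have int: "(\<integral>w. y * \<psi> w \<partial>two_coord X T p) = y * ?r p" for p
    by (simp add: rotation_value_def)
  have p: "p \<in> ?S" and max: "kernel_entropy X p + ereal (y * ?r p) =
      (SUP p'\<in>?S. kernel_entropy X p' + ereal (y * ?r p'))"
    using p unfolding linear_equilibrium_pairs_def int by blast+
  have "ereal (P y) \<le> (SUP p'\<in>?S. kernel_entropy X p' + ereal (y * ?r p'))"
  proof -
    let ?z = "deriv P y"
    have z: "?z \<in> R" using range interior_subset by blast
    have "ereal (P y - y * ?z) \<le> localized_entropy X T \<psi> ?z"
      unfolding h[OF z] using tangent by (intro INF_greatest) simp
    hence "ereal (P y) \<le> localized_entropy X T \<psi> ?z + ereal (y * ?z)"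
      by (cases "localized_entropy X T \<psi> ?z") auto
    also have "localized_entropy X T \<psi> ?z + ereal (y * ?z) =
        (SUP p'\<in>{p \<in> ?S. ?r p = ?z}. kernel_entropy X p' + ereal (y * ?z))"
    proof -
      obtain p where "p \<in> ?S" "?r p = ?z"
        using z unfolding R_def rotation_set_def by (metis imageE)
      hence "{p \<in> ?S. ?r p = ?z} \<noteq> {}" by blast
      thus ?thesis
        unfolding localized_entropy_def by (rule SUP_ereal_add_left[symmetric]) simp
    qed
    also have "\<dots> \<le> (SUP p'\<in>?S. kernel_entropy X p' + ereal (y * ?r p'))"
      by (rule SUP_least) (auto intro!: SUP_upper2)
    finally show ?thesis .
  qed
  hence ge: "ereal (P y) \<le> kernel_entropy X p + ereal (y * ?r p)" using max by simp
  have le: "kernel_entropy X p \<le> ereal (P y' - y' * ?r p)" for y'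
    using kernel_entropy_le[OF L p] by (simp add: P_def)
  obtain e where e: "kernel_entropy X p = ereal e"
    using ge le[of 0] by (cases "kernel_entropy X p") auto
  have e_eq: "e = P y - y * ?r p" using ge le[of y] by (simp add: e)
  have "deriv P y = ?r p"
  proof (rule deriv_eq_of_supporting_line[OF D])
    show "P y - y * ?r p \<le> P y' - y' * ?r p" for y' using le[of y'] e_eq by (simp add: e)
  qed
  thus "?r p = deriv (pressure_fun X T \<psi>) y"
    and "kernel_entropy X p = ereal (pressure_fun X T \<psi> y - y * deriv (pressure_fun X T \<psi>) y)"
    using e e_eq by (simp_all add: P_def)
qed

section \<open>The nonlinear variational problem\<close>

lemma mem_equilibrium_values_iff:
  "z \<in> equilibrium_values X T \<psi> \<beta> \<longleftrightarrow>
     (\<exists>p\<in>stationary_pairs X T. rotation_value X T \<psi> p = z \<and>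
        (\<forall>p'\<in>stationary_pairs X T.
           kernel_entropy X p' + ereal (\<beta> / 2 * (rotation_value X T \<psi> p')\<^sup>2) \<le>
           kernel_entropy X p + ereal (\<beta> / 2 * z\<^sup>2)))"
  unfolding equilibrium_values_def nonlinear_equilibrium_pairs_def quadratic_energy_def
    rotation_value_def[symmetric] by auto

text \<open>
  The facts about a system and its pressure \<open>P\<close>, with derivative \<open>D\<close>, from which the critical behaviour
  follows. Entropy enters only through \<open>entropy_le\<close> and \<open>attained\<close>.
\<close>

locale even_pressure_system =
  fixes X :: "'a metric" and T :: "'a \<Rightarrow> 'a set" and \<psi> :: "'a \<times> 'a \<Rightarrow> real"
    and P D :: "real \<Rightarrow> real"
  assumes entropy_le: "\<And>p y. p \<in> stationary_pairs X T \<Longrightarrow>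
      kernel_entropy X p \<le> ereal (P y - y * rotation_value X T \<psi> p)"
    and attained: "\<And>y. \<exists>p\<in>stationary_pairs X T. rotation_value X T \<psi> p = D y \<and>
      kernel_entropy X p = ereal (P y - y * D y)"
    and P_deriv: "\<And>y. (P has_real_derivative D y) (at y)"
    and D_deriv: "\<And>y. (D has_real_derivative deriv D y) (at y)"
    and P_even: "\<And>y. P (- y) = P y"
    and D_pos: "\<And>y. y > 0 \<Longrightarrow> D y > 0"
    and D_bounded: "\<exists>M. \<forall>y. D y \<le> M"
    and ratio_mono: "strict_mono_on {0<..} (\<lambda>y. y / D y)"
begin

text \<open>
  The dual functional, whose maximizers \<open>y\<close> correspond to the equilibrium values \<open>y / \<beta>\<close>.
\<close>

definition \<Phi> :: "real \<Rightarrow> real \<Rightarrow> real" where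
  "\<Phi> \<beta> y = P y - y\<^sup>2 / (2 * \<beta>)"

lemma D_odd: "D (- y) = - D y"
proof -
  have "((\<lambda>y. P (- y)) has_real_derivative - D (- y)) (at y)"
    using DERIV_chain'[OF DERIV_minus[OF DERIV_ident] P_deriv, of y] by simp
  hence "(P has_real_derivative - D (- y)) (at y)" by (simp add: P_even)
  from DERIV_unique[OF this P_deriv] show ?thesis by simp
qed

lemma D_0: "D 0 = 0"
  using D_odd[of 0] by simp

lemma ratio_less: "0 < y \<Longrightarrow> y < y' \<Longrightarrow> y / D y < y' / D y'"
  using ratio_mono by (auto simp: strict_mono_on_def)

lemma \<Phi>_even: "\<Phi> \<beta> (- y) = \<Phi> \<beta> y"
  by (simp add: \<Phi>_def P_even)

lemma \<Phi>_deriv: "\<beta> > 0 \<Longrightarrow> (\<Phi> \<beta> has_real_derivative D y - y / \<beta>) (at y)"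
  unfolding \<Phi>_def[abs_def] by (auto intro!: derivative_eq_intros P_deriv)

lemma free_energy_le:
  assumes \<beta>: "\<beta> > 0" and p: "p \<in> stationary_pairs X T"
  shows "kernel_entropy X p + ereal (\<beta> / 2 * (rotation_value X T \<psi> p)\<^sup>2) \<le>
    ereal (\<Phi> \<beta> (\<beta> * rotation_value X T \<psi> p))"
proof -
  let ?z = "rotation_value X T \<psi> p"
  have "kernel_entropy X p + ereal (\<beta> / 2 * ?z\<^sup>2) \<le>
      ereal (P (\<beta> * ?z) - \<beta> * ?z * ?z) + ereal (\<beta> / 2 * ?z\<^sup>2)"
    by (intro add_right_mono entropy_le p)
  also have "\<dots> = ereal (\<Phi> \<beta> (\<beta> * ?z))"
    using \<beta> by (simp add: \<Phi>_def power2_eq_square field_simps)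
  finally show ?thesis .
qed

lemma free_energy_attained:
  assumes \<beta>: "\<beta> > 0" and y: "D y = y / \<beta>"
  obtains p where "p \<in> stationary_pairs X T" "rotation_value X T \<psi> p = y / \<beta>"
    "kernel_entropy X p + ereal (\<beta> / 2 * (y / \<beta>)\<^sup>2) = ereal (\<Phi> \<beta> y)"
proof -
  obtain p where p: "p \<in> stationary_pairs X T" "rotation_value X T \<psi> p = D y"
      "kernel_entropy X p = ereal (P y - y * D y)"
    using attained by blast
  have "kernel_entropy X p + ereal (\<beta> / 2 * (y / \<beta>)\<^sup>2) = ereal (\<Phi> \<beta> y)"
    using \<beta> by (simp add: p(3) y \<Phi>_def power2_eq_square field_simps)
  with p(1,2) y show thesis by (intro that) auto
qed

text \<open>
  If \<open>Y\<close> and \<open>- Y\<close> are the only maximizers of \<open>\<Phi> \<beta>\<close>, then the equilibrium values are \<open>\<plusminus> Y / \<beta>\<close>: the free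
  energy of a pair with rotation value \<open>z\<close> is at most \<open>\<Phi> \<beta> (\<beta> z)\<close>, and the linear equilibrium pairs at
  \<open>\<plusminus> Y\<close> reach \<open>\<Phi> \<beta> Y\<close>. For \<open>Y = 0\<close> the two values coincide.
\<close>

lemma equilibrium_values_eq:
  assumes \<beta>: "\<beta> > 0" and Y: "Y \<ge> 0" "D Y = Y / \<beta>"
    and max: "\<And>y. y \<ge> 0 \<Longrightarrow> y \<noteq> Y \<Longrightarrow> \<Phi> \<beta> y < \<Phi> \<beta> Y"
  shows "equilibrium_values X T \<psi> \<beta> = {Y / \<beta>, - (Y / \<beta>)}"
proof -
  have lt: "\<Phi> \<beta> y < \<Phi> \<beta> Y" if "y \<noteq> Y" "y \<noteq> - Y" for y
    using max[of y] max[of "- y"] that \<Phi>_even[of \<beta> y] by (cases "y \<ge> 0") auto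
  hence le: "\<Phi> \<beta> y \<le> \<Phi> \<beta> Y" for y
    using \<Phi>_even[of \<beta> Y] by (cases "y = Y \<or> y = - Y") (auto intro: less_imp_le)
  have mem: "y / \<beta> \<in> equilibrium_values X T \<psi> \<beta>" if y: "y = Y \<or> y = - Y" for y
  proof -
    have "D y = y / \<beta>" using y Y D_odd by auto
    then obtain p where p: "p \<in> stationary_pairs X T" "rotation_value X T \<psi> p = y / \<beta>"
      "kernel_entropy X p + ereal (\<beta> / 2 * (y / \<beta>)\<^sup>2) = ereal (\<Phi> \<beta> y)"
      using free_energy_attained[OF \<beta>] by blast
    have "\<Phi> \<beta> y = \<Phi> \<beta> Y" using y \<Phi>_even by auto
    hence "kernel_entropy X p' + ereal (\<beta> / 2 * (rotation_value X T \<psi> p')\<^sup>2) \<le> ereal (\<Phi> \<beta> y)"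
      if "p' \<in> stationary_pairs X T" for p'
      using order_trans[OF free_energy_le[OF \<beta> that]] le by simp
    with p show ?thesis
      unfolding mem_equilibrium_values_iff by (intro bexI[of _ p]) auto
  qed
  have "z = Y / \<beta> \<or> z = - (Y / \<beta>)" if z: "z \<in> equilibrium_values X T \<psi> \<beta>" for z
  proof -
    obtain p where p: "p \<in> stationary_pairs X T" "rotation_value X T \<psi> p = z"
      and pmax: "\<And>p'. p' \<in> stationary_pairs X T \<Longrightarrow>
           kernel_entropy X p' + ereal (\<beta> / 2 * (rotation_value X T \<psi> p')\<^sup>2) \<le>
           kernel_entropy X p + ereal (\<beta> / 2 * z\<^sup>2)"
      using z unfolding mem_equilibrium_values_iff by blast
    obtain p0 where p0: "p0 \<in> stationary_pairs X T" "rotation_value X T \<psi> p0 = Y / \<beta>"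
      "kernel_entropy X p0 + ereal (\<beta> / 2 * (Y / \<beta>)\<^sup>2) = ereal (\<Phi> \<beta> Y)"
      using free_energy_attained[OF \<beta> Y(2)] by blast
    have "ereal (\<Phi> \<beta> Y) \<le> kernel_entropy X p + ereal (\<beta> / 2 * z\<^sup>2)"
      using pmax[OF p0(1)] p0(2,3) by simp
    also have "\<dots> \<le> ereal (\<Phi> \<beta> (\<beta> * z))"
      using free_energy_le[OF \<beta> p(1)] p(2) by simp
    finally have "\<not> \<Phi> \<beta> (\<beta> * z) < \<Phi> \<beta> Y" by simp
    hence "\<beta> * z = Y \<or> \<beta> * z = - Y" using lt by blast
    thus ?thesis using \<beta> by (auto simp: field_simps)
  qed
  moreover have "Y / \<beta> \<in> equilibrium_values X T \<psi> \<beta>" "- (Y / \<beta>) \<in> equilibrium_values X T \<psi> \<beta>"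
    using mem[of Y] mem[of "- Y"] by auto
  ultimately show ?thesis by blast
qed

text \<open>
  At \<open>\<beta> = 0\<close> the functional \<open>\<Phi>\<close> is not available; the energy vanishes and the maximizer of the entropy
  is identified by its supporting line.
\<close>

lemma equilibrium_values_0: "equilibrium_values X T \<psi> 0 = {0}"
proof -
  obtain p0 where p0: "p0 \<in> stationary_pairs X T" "rotation_value X T \<psi> p0 = 0"
      "kernel_entropy X p0 = ereal (P 0)"
    using attained[of 0] by (auto simp: D_0)
  have le: "kernel_entropy X p \<le> ereal (P 0)" if "p \<in> stationary_pairs X T" for p
    using entropy_le[OF that, of 0] by simp
  have "z = 0" if "z \<in> equilibrium_values X T \<psi> 0" for z
  proof -
    obtain p where p: "p \<in> stationary_pairs X T" "rotation_value X T \<psi> p = z"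
      and pmax: "kernel_entropy X p0 \<le> kernel_entropy X p"
    proof -
      obtain p where "p \<in> stationary_pairs X T" "rotation_value X T \<psi> p = z"
        and "\<forall>p'\<in>stationary_pairs X T.
           kernel_entropy X p' + ereal (0 / 2 * (rotation_value X T \<psi> p')\<^sup>2) \<le>
           kernel_entropy X p + ereal (0 / 2 * z\<^sup>2)"
        using \<open>z \<in> _\<close> unfolding mem_equilibrium_values_iff by blast
      with p0(1) show thesis by (intro that[of p]) (auto simp: zero_ereal_def[symmetric])
    qed
    have "ereal (P 0) \<le> ereal (P y' - y' * z)" for y'
      using order_trans[OF pmax entropy_le[OF p(1), of y']] unfolding p0(3) p(2) .
    hence "D 0 = z"
      by (intro deriv_eq_of_supporting_line[OF P_deriv]) simp
    thus ?thesis by (simp add: D_0)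
  qed
  moreover have "0 \<in> equilibrium_values X T \<psi> 0"
    unfolding mem_equilibrium_values_iff using p0 le
    by (auto simp: zero_ereal_def[symmetric] intro!: bexI[of _ p0])
  ultimately show ?thesis by blast
qed

lemma \<Phi>_unique_max:
  assumes \<beta>: "\<beta> > 0" and Y: "Y \<ge> 0"
    and below: "\<And>y. 0 < y \<Longrightarrow> y < Y \<Longrightarrow> y / D y < \<beta>"
    and above: "\<And>y. Y < y \<Longrightarrow> \<beta> < y / D y"
    and y: "y \<ge> 0" "y \<noteq> Y"
  shows "\<Phi> \<beta> y < \<Phi> \<beta> Y"
proof -
  have cont: "continuous_on S (\<Phi> \<beta>)" for S
    by (rule DERIV_continuous_on) (rule has_field_derivative_at_within[OF \<Phi>_deriv[OF \<beta>]])
  consider "y < Y" | "Y < y" using y by linarith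
  thus ?thesis
  proof cases
    case 1
    show ?thesis
    proof (rule DERIV_pos_imp_increasing_open[OF 1 _ cont])
      fix x assume x: "y < x" "x < Y"
      hence "x / D x < \<beta>" "D x > 0" using below D_pos y by auto
      hence "D x - x / \<beta> > 0" using \<beta> by (simp add: field_simps)
      thus "\<exists>d. (\<Phi> \<beta> has_real_derivative d) (at x) \<and> d > 0" using \<Phi>_deriv[OF \<beta>] by blast
    qed
  next
    case 2
    show ?thesis
    proof (rule DERIV_neg_imp_decreasing_open[OF 2 _ cont])
      fix x assume x: "Y < x" "x < y"
      hence "\<beta> < x / D x" "D x > 0" using above D_pos Y by auto
      hence "D x - x / \<beta> < 0" using \<beta> by (simp add: field_simps)
      thus "\<exists>d. (\<Phi> \<beta> has_real_derivative d) (at x) \<and> d < 0" using \<Phi>_deriv[OF \<beta>] by blast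
    qed
  qed
qed

text \<open>
  The second derivative of \<open>P\<close> at \<open>0\<close>, whose inverse is the critical inverse temperature.
\<close>

definition a :: real where "a = deriv D 0"

lemma D_slope: "((\<lambda>y. D y / y) \<longlongrightarrow> a) (at_right 0)"
proof -
  have "(D has_real_derivative a) (at 0)"
    unfolding a_def by (rule D_deriv)
  hence "((\<lambda>y. D y / y) \<longlongrightarrow> a) (at 0)"
    by (simp add: has_field_derivative_iff D_0)
  thus ?thesis by (rule tendsto_mono[OF at_le, rotated]) simp
qed

text \<open>
  By monotonicity of \<open>y / D y\<close>, the quotient \<open>D y / y\<close> is at least \<open>D 1\<close> for \<open>0 < y < 1\<close>.
\<close>

lemma a_pos: "a > 0"
proof -
  have "D 1 \<le> a"
  proof (rule tendsto_lowerbound[OF D_slope])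
    have "\<forall>\<^sub>F y in at_right 0. y < (1::real)"
      by (rule order_tendstoD(2)[OF tendsto_ident_at]) simp
    thus "\<forall>\<^sub>F y in at_right 0. D 1 \<le> D y / y"
      using eventually_at_right_less[of "0::real"]
    proof eventually_elim
      case (elim y)
      have "y / D y < 1 / D 1" using ratio_less[of y 1] elim by simp
      thus ?case using D_pos[of y] D_pos[of 1] elim by (simp add: field_simps)
    qed
  qed simp
  thus ?thesis using D_pos[of 1] by simp
qed

lemma supercritical_pos: "1 / a < \<beta> \<Longrightarrow> \<beta> > 0"
  using a_pos by (intro less_trans[of 0 "1 / a" \<beta>]) auto

lemma ratio_limit: "((\<lambda>y. y / D y) \<longlongrightarrow> 1 / a) (at_right 0)"
  using tendsto_inverse[OF D_slope] a_pos by (simp add: inverse_eq_divide)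

lemma ratio_gt: "y > 0 \<Longrightarrow> 1 / a < y / D y"
proof -
  assume y: "y > 0"
  have "1 / a \<le> (y / 2) / D (y / 2)"
  proof (rule tendsto_upperbound[OF ratio_limit])
    have "\<forall>\<^sub>F x in at_right 0. x < y / 2"
      using y by (intro order_tendstoD(2)[OF tendsto_ident_at]) simp
    thus "\<forall>\<^sub>F x in at_right 0. x / D x \<le> (y / 2) / D (y / 2)"
      using eventually_at_right_less[of "0::real"]
      by eventually_elim (use ratio_less in \<open>fastforce intro: less_imp_le\<close>)
  qed simp
  also have "\<dots> < y / D y" using ratio_less[of "y / 2" y] y by simp
  finally show ?thesis .
qed

lemma D_continuous_on: "continuous_on S D"
  by (rule DERIV_continuous_on) (rule has_field_derivative_at_within[OF D_deriv])

text \<open>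
  The bound on \<open>D\<close> makes \<open>y / D y\<close> unbounded, so every value above its limit at \<open>0\<close> is attained.
\<close>

lemma ratio_surj:
  assumes \<beta>: "\<beta> > 1 / a"
  obtains y where "y > 0" "y / D y = \<beta>"
proof -
  have \<beta>0: "\<beta> > 0" by (rule supercritical_pos[OF \<beta>])
  have "\<forall>\<^sub>F y in at_right 0. y / D y < \<beta>"
    using order_tendstoD(2)[OF ratio_limit \<beta>] .
  then obtain b where "b > 0" and b: "\<And>y. 0 < y \<Longrightarrow> y < b \<Longrightarrow> y / D y < \<beta>"
    unfolding eventually_at_right_field by blast
  define y1 where "y1 = b / 2"
  have y1: "y1 > 0" "y1 / D y1 < \<beta>" using \<open>b > 0\<close> b[of y1] by (auto simp: y1_def)
  obtain M where M: "\<And>y. D y \<le> M" using D_bounded by blast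
  have "M > 0" using M[of 1] D_pos[of 1] by simp
  define y2 where "y2 = \<beta> * M"
  have y2: "y2 > 0" using \<beta>0 \<open>M > 0\<close> by (simp add: y2_def)
  have "\<beta> \<le> y2 / D y2"
    using M[of y2] D_pos[OF y2] \<beta>0 by (simp add: y2_def field_simps mult_left_mono)
  moreover have "y1 \<le> y2"
    using ratio_less[of y2 y1] y1 y2 calculation by (cases "y1 \<le> y2") auto
  moreover have "continuous_on {y1..y2} (\<lambda>y. y / D y)"
  proof (intro continuous_on_divide continuous_on_id D_continuous_on ballI)
    fix x assume "x \<in> {y1..y2}"
    with y1 have "x > 0" by simp
    thus "D x \<noteq> 0" using D_pos[of x] by simp
  qed
  ultimately obtain y where "y1 \<le> y" "y / D y = \<beta>"
    using IVT'[of "\<lambda>y. y / D y" y1 \<beta> y2] y1 by auto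
  thus thesis using y1 by (intro that) auto
qed

text \<open>
  The positive maximizer of \<open>\<Phi> \<beta>\<close>, meaningful for \<open>\<beta> > 1 / a\<close>, where the ratio takes the value \<open>\<beta>\<close>
  exactly once.
\<close>

definition Y :: "real \<Rightarrow> real" where "Y \<beta> = (SOME y. y > 0 \<and> y / D y = \<beta>)"

lemma Y_solves:
  assumes "\<beta> > 1 / a"
  shows "Y \<beta> > 0" "Y \<beta> / D (Y \<beta>) = \<beta>"
proof -
  have "\<exists>y. y > 0 \<and> y / D y = \<beta>" using ratio_surj[OF assms] by blast
  from someI_ex[OF this] show "Y \<beta> > 0" "Y \<beta> / D (Y \<beta>) = \<beta>" by (simp_all add: Y_def)
qed

lemma equilibrium_values_supercritical:
  assumes \<beta>: "\<beta> > 1 / a"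
  shows "equilibrium_values X T \<psi> \<beta> = {Y \<beta> / \<beta>, - (Y \<beta> / \<beta>)}"
proof (rule equilibrium_values_eq)
  show \<beta>0: "\<beta> > 0" by (rule supercritical_pos[OF \<beta>])
  show "Y \<beta> \<ge> 0" "D (Y \<beta>) = Y \<beta> / \<beta>"
    using Y_solves[OF \<beta>] \<beta>0 D_pos[of "Y \<beta>"] by (auto simp: field_simps)
  show "\<Phi> \<beta> y < \<Phi> \<beta> (Y \<beta>)" if "y \<ge> 0" "y \<noteq> Y \<beta>" for y
    by (rule \<Phi>_unique_max[OF \<beta>0]) (use Y_solves[OF \<beta>] ratio_less that in fastforce)+
qed

lemma critical_inverse_temperature:
  "is_critical_inverse_temperature X T \<psi> (1 / a)"
  unfolding is_critical_inverse_temperature_def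
proof (intro conjI allI impI)
  show "0 \<le> 1 / a" using a_pos by simp
  fix \<beta> assume \<beta>: "0 \<le> \<beta> \<and> \<beta> \<le> 1 / a"
  show "equilibrium_values X T \<psi> \<beta> = {0}"
  proof (cases "\<beta> = 0")
    case True
    thus ?thesis by (simp add: equilibrium_values_0)
  next
    case False
    with \<beta> have \<beta>0: "\<beta> > 0" by simp
    have "equilibrium_values X T \<psi> \<beta> = {0 / \<beta>, - (0 / \<beta>)}"
    proof (rule equilibrium_values_eq[OF \<beta>0])
      show "\<Phi> \<beta> y < \<Phi> \<beta> 0" if "y \<ge> 0" "y \<noteq> 0" for y
        by (rule \<Phi>_unique_max[OF \<beta>0]) (use ratio_gt \<beta> that in fastforce)+
    qed (auto simp: D_0)
    thus ?thesis by simp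
  qed
next
  fix \<beta> assume \<beta>: "1 / a < \<beta>"
  have "\<beta> > 0" by (rule supercritical_pos[OF \<beta>])
  with Y_solves(1)[OF \<beta>] have "Y \<beta> / \<beta> > 0" by simp
  with equilibrium_values_supercritical[OF \<beta>]
  show "\<exists>z>0. equilibrium_values X T \<psi> \<beta> = {z, - z}" by blast
qed

lemma positive_equilibrium_value_eq:
  assumes \<beta>: "\<beta> > 1 / a"
  shows "positive_equilibrium_value X T \<psi> \<beta> = Y \<beta> / \<beta>"
proof -
  have "\<beta> > 0" by (rule supercritical_pos[OF \<beta>])
  with Y_solves(1)[OF \<beta>] have "Y \<beta> / \<beta> > 0" by simp
  thus ?thesis
    unfolding positive_equilibrium_value_def equilibrium_values_supercritical[OF \<beta>]
    by (intro the_equality) auto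
qed

lemma Y_tendsto: "filterlim Y (at_right 0) (at_right (1 / a))"
proof -
  have pos: "\<forall>\<^sub>F \<beta> in at_right (1 / a). Y \<beta> > 0"
    using eventually_at_right_less by eventually_elim (rule Y_solves(1))
  have "(Y \<longlongrightarrow> 0) (at_right (1 / a))"
  proof (rule order_tendstoI)
    fix e :: real assume e: "0 < e"
    have "\<forall>\<^sub>F \<beta> in at_right (1 / a). \<beta> < e / D e"
      by (rule order_tendstoD(2)[OF tendsto_ident_at ratio_gt[OF e]])
    with eventually_at_right_less[of "1 / a"] show "\<forall>\<^sub>F \<beta> in at_right (1 / a). Y \<beta> < e"
    proof eventually_elim
      case (elim \<beta>)
      show ?case
      proof (rule ccontr)
        assume "\<not> Y \<beta> < e"
        hence "e / D e \<le> Y \<beta> / D (Y \<beta>)" using ratio_less[OF e, of "Y \<beta>"] by (cases "Y \<beta> = e") auto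
        thus False using Y_solves[OF elim(1)] elim(2) by simp
      qed
    qed
  next
    fix e :: real assume "e < 0"
    thus "\<forall>\<^sub>F \<beta> in at_right (1 / a). e < Y \<beta>" using pos by (auto elim: eventually_mono)
  qed
  thus ?thesis using pos by (auto simp: filterlim_at elim: eventually_mono)
qed

text \<open>
  Substituting \<open>y = Y \<beta>\<close> in the limit \<open>lim\<close>, where \<open>D y / y = 1 / \<beta>\<close> and
  \<open>a - 1 / \<beta> = (a / \<beta>) (\<beta> - 1 / a)\<close>, gives \<open>Y\<^bsup>2k\<^esup> / (\<beta> - 1 / a) \<rightarrow> a\<^sup>2 / (- c)\<close>.
\<close>

lemma positive_equilibrium_value_asymp:
  assumes k: "k \<ge> 1" and c: "c < 0"
    and lim: "((\<lambda>y. (a - D y / y) / y ^ (2 * k)) \<longlongrightarrow> - c) (at_right 0)"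
  shows "positive_equilibrium_value X T \<psi> \<sim>[at_right (1 / a)]
    (\<lambda>\<beta>. a * (a\<^sup>2 / (- c)) powr (1 / (2 * real k)) * (\<beta> - 1 / a) powr (1 / (2 * real k)))"
proof (rule asymp_equivI'_const)
  let ?F = "at_right (1 / a)" and ?s = "1 / (2 * real k)"
  have \<beta>_lim: "((\<lambda>\<beta>. \<beta>) \<longlongrightarrow> 1 / a) ?F" by (rule tendsto_ident_at)
  have "((\<lambda>\<beta>. (a - D (Y \<beta>) / Y \<beta>) / Y \<beta> ^ (2 * k)) \<longlongrightarrow> - c) ?F"
    by (rule filterlim_compose[OF lim Y_tendsto])
  hence "((\<lambda>\<beta>. a / \<beta> * inverse ((a - D (Y \<beta>) / Y \<beta>) / Y \<beta> ^ (2 * k))) \<longlongrightarrow>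
      a / (1 / a) * inverse (- c)) ?F"
    using a_pos c by (intro tendsto_intros \<beta>_lim) auto
  hence "((\<lambda>\<beta>. Y \<beta> ^ (2 * k) / (\<beta> - 1 / a)) \<longlongrightarrow> a / (1 / a) * inverse (- c)) ?F"
  proof (rule Lim_transform_eventually)
    show "\<forall>\<^sub>F \<beta> in ?F. a / \<beta> * inverse ((a - D (Y \<beta>) / Y \<beta>) / Y \<beta> ^ (2 * k)) =
        Y \<beta> ^ (2 * k) / (\<beta> - 1 / a)"
      using eventually_at_right_less[of "1 / a"]
    proof eventually_elim
      case (elim \<beta>)
      have \<beta>: "\<beta> > 0" by (rule supercritical_pos[OF elim])
      have "D (Y \<beta>) / Y \<beta> = 1 / \<beta>" using Y_solves[OF elim] \<beta> by (metis inverse_divide inverse_eq_divide)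
      moreover have "a - 1 / \<beta> = a / \<beta> * (\<beta> - 1 / a)" using \<beta> a_pos by (simp add: field_simps)
      ultimately show ?case using \<beta> a_pos by simp
    qed
  qed
  hence "((\<lambda>\<beta>. (Y \<beta> ^ (2 * k) / (\<beta> - 1 / a)) powr ?s) \<longlongrightarrow> (a\<^sup>2 / (- c)) powr ?s) ?F"
    using a_pos c
    by (intro tendsto_powr) (auto simp: power2_eq_square field_simps)
  hence "((\<lambda>\<beta>. 1 / \<beta> * (Y \<beta> ^ (2 * k) / (\<beta> - 1 / a)) powr ?s) \<longlongrightarrow>
      1 / (1 / a) * (a\<^sup>2 / (- c)) powr ?s) ?F"
    using a_pos by (intro tendsto_mult tendsto_divide tendsto_const \<beta>_lim) auto
  hence "((\<lambda>\<beta>. positive_equilibrium_value X T \<psi> \<beta> / (\<beta> - 1 / a) powr ?s) \<longlongrightarrow>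
      1 / (1 / a) * (a\<^sup>2 / (- c)) powr ?s) ?F"
  proof (rule Lim_transform_eventually)
    show "\<forall>\<^sub>F \<beta> in ?F. 1 / \<beta> * (Y \<beta> ^ (2 * k) / (\<beta> - 1 / a)) powr ?s =
        positive_equilibrium_value X T \<psi> \<beta> / (\<beta> - 1 / a) powr ?s"
      using eventually_at_right_less[of "1 / a"]
    proof eventually_elim
      case (elim \<beta>)
      have "(Y \<beta> ^ (2 * k)) powr ?s = (Y \<beta> powr real (2 * k)) powr ?s"
        using Y_solves(1)[OF elim] by (simp only: powr_realpow)
      also have "\<dots> = Y \<beta>"
        using Y_solves(1)[OF elim] k by (simp add: powr_powr)
      finally show ?case
        using elim Y_solves(1)[OF elim] by (simp add: positive_equilibrium_value_eq powr_divide)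
    qed
  qed
  thus "((\<lambda>\<beta>. positive_equilibrium_value X T \<psi> \<beta> / (\<beta> - 1 / a) powr ?s) \<longlongrightarrow>
      a * (a\<^sup>2 / (- c)) powr ?s) ?F" by simp
  show "a * (a\<^sup>2 / (- c)) powr ?s \<noteq> 0" using a_pos c by simp
qed

end

section \<open>Critical behaviour of a single system\<close>

text \<open>
  Positivity of the derivative on the positive axis comes from convexity and injectivity, its
  boundedness from the fact that its values are rotation values.
\<close>

lemma even_pressure_system_of_legendre:
  assumes X: "compact_space (mtopology_of X)" and T: "correspondence X T"
    and \<psi>: "continuous_map (graph_topology X T) euclideanreal \<psi>"
    and L: "legendre_assumptions X T \<psi>"
    and uniq: "unique_linear_equilibrium_pairs X T \<psi>"
    and even: "\<And>y. pressure_fun X T \<psi> (- y) = pressure_fun X T \<psi> y"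
    and mono: "strict_mono_on {0<..} (\<lambda>y. y / deriv (pressure_fun X T \<psi>) y)"
  shows "even_pressure_system X T \<psi> (pressure_fun X T \<psi>) (deriv (pressure_fun X T \<psi>))"
proof -
  define P where "P = pressure_fun X T \<psi>"
  let ?D = "deriv P"
  have an: "real_analytic_on P UNIV" and anD: "real_analytic_on ?D UNIV"
    and sc: "strictly_convex_on UNIV P" and inj: "inj ?D"
    using L by (auto simp: legendre_assumptions_def Let_def P_def homeomorphism_def intro: inj_on_inverseI)
  have D: "(P has_real_derivative ?D y) (at y)" for y
    using real_analytic_on_has_derivative[OF an] by simp
  have D2: "(?D has_real_derivative deriv ?D y) (at y)" for y
    using real_analytic_on_has_derivative[OF anD] by simp
  have tangent: "P y' - P y \<ge> ?D y * (y' - y)" for y y'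
    using convex_on_imp_above_tangent[OF convex_on_of_strictly_convex_on[OF sc], of y y' "?D y"] D
    by simp
  have att: "\<exists>p\<in>stationary_pairs X T. rotation_value X T \<psi> p = ?D y \<and>
      kernel_entropy X p = ereal (P y - y * ?D y)" for y
  proof -
    obtain p where p: "p \<in> linear_equilibrium_pairs X T (\<lambda>w. y * \<psi> w)"
      using uniq unfolding unique_linear_equilibrium_pairs_def by blast
    hence "p \<in> stationary_pairs X T" by (simp add: linear_equilibrium_pairs_def)
    thus ?thesis
      using linear_equilibrium_pair_attains[OF L p] unfolding P_def by blast
  qed
  have D_0: "?D 0 = 0"
  proof -
    have "((\<lambda>y. P (- y)) has_real_derivative - ?D (- 0)) (at 0)"
      using DERIV_chain'[OF DERIV_minus[OF DERIV_ident] D, of 0] by simp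
    hence "(P has_real_derivative - ?D 0) (at 0)" using even by (simp add: P_def)
    from DERIV_unique[OF this D] show ?thesis by simp
  qed
  have pos: "?D y > 0" if y: "y > 0" for y
  proof -
    have "y * ?D y \<ge> 0" using tangent[of y 0] tangent[of 0 y] by (simp add: D_0 algebra_simps)
    moreover have "?D y \<noteq> ?D 0" using inj y by (metis injD less_irrefl)
    ultimately show ?thesis using y D_0 by (simp add: zero_le_mult_iff)
  qed
  have bdd: "\<exists>M. \<forall>y. ?D y \<le> M"
  proof -
    obtain M where M: "\<And>p. p \<in> stationary_pairs X T \<Longrightarrow> \<bar>rotation_value X T \<psi> p\<bar> \<le> M"
      using rotation_value_bounded[OF X T \<psi>] by blast
    have "?D y \<le> M" for y
      using att[of y] M by fastforce
    thus ?thesis by blast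
  qed
  show ?thesis
    unfolding P_def[symmetric]
  proof unfold_locales
    show "kernel_entropy X p \<le> ereal (P y - y * rotation_value X T \<psi> p)"
      if "p \<in> stationary_pairs X T" for p y
      unfolding P_def by (rule kernel_entropy_le[OF L that])
  qed (use att D D2 pos bdd even mono in \<open>simp_all add: P_def\<close>)
qed

lemma critical_behaviour:
  assumes X: "compact_space (mtopology_of X)" and T: "correspondence X T"
    and \<psi>: "continuous_map (graph_topology X T) euclideanreal \<psi>"
    and L: "legendre_assumptions X T \<psi>"
    and uniq: "unique_linear_equilibrium_pairs X T \<psi>"
    and even: "\<And>y. pressure_fun X T \<psi> (- y) = pressure_fun X T \<psi> y"
    and mono: "strict_mono_on {0<..} (\<lambda>y. y / deriv (pressure_fun X T \<psi>) y)"
  defines "P \<equiv> pressure_fun X T \<psi>"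
  defines "a \<equiv> pressure_lin_coeff P" and "c \<equiv> pressure_odd_coeff P"
  shows "a > 0"
    and "\<forall>\<^sub>F y in nhds 0. (\<lambda>j. c (Suc j) * y ^ (2 * Suc j + 1)) sums (deriv P y - a * y)"
    and "\<And>k. 1 \<le> k \<Longrightarrow> (\<And>i. 1 \<le> i \<Longrightarrow> i < k \<Longrightarrow> c i = 0) \<Longrightarrow> c k < 0 \<Longrightarrow>
      is_critical_inverse_temperature X T \<psi> (1 / a) \<and>
      positive_equilibrium_value X T \<psi> \<sim>[at_right (1 / a)]
        (\<lambda>\<beta>. a * (a\<^sup>2 / (- c k)) powr (1 / (2 * real k)) * (\<beta> - 1 / a) powr (1 / (2 * real k))) \<and>
      is_critical_exponent X T \<psi> (1 / (2 * real k))"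
proof -
  interpret S: even_pressure_system X T \<psi> P "deriv P"
    unfolding P_def by (rule even_pressure_system_of_legendre[OF X T \<psi> L uniq even mono])
  have a: "a = S.a" by (simp add: a_def S.a_def pressure_lin_coeff_def)
  have an: "real_analytic_on (deriv P) UNIV"
    using L by (auto simp: legendre_assumptions_def Let_def P_def)
  have c: "c = (\<lambda>j. (deriv ^^ (2 * j + 1)) (deriv P) 0 / fact (2 * j + 1))"
    unfolding c_def pressure_odd_coeff_def by (rule ext) (rule refl)
  have a': "a = deriv (deriv P) 0" by (simp add: a_def pressure_lin_coeff_def)
  show pos: "a > 0" unfolding a by (rule S.a_pos)
  show "\<forall>\<^sub>F y in nhds 0. (\<lambda>j. c (Suc j) * y ^ (2 * Suc j + 1)) sums (deriv P y - a * y)"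
    unfolding c a' by (rule odd_analytic_Taylor(1)[OF an S.D_odd])
  fix k :: nat
  assume k: "1 \<le> k" and z: "\<And>i. 1 \<le> i \<Longrightarrow> i < k \<Longrightarrow> c i = 0" and neg: "c k < 0"
  have "((\<lambda>y. (deriv (deriv P) 0 - deriv P y / y) / y ^ (2 * k)) \<longlongrightarrow> - c k) (at 0)"
    using odd_analytic_Taylor(2)[OF an S.D_odd k] z unfolding c by blast
  hence "((\<lambda>y. (a - deriv P y / y) / y ^ (2 * k)) \<longlongrightarrow> - c k) (at_right 0)"
    unfolding a' by (rule tendsto_mono[OF at_le, rotated]) simp
  from S.positive_equilibrium_value_asymp[OF k neg this[unfolded a]]
  have asymp: "positive_equilibrium_value X T \<psi> \<sim>[at_right (1 / a)]
      (\<lambda>\<beta>. a * (a\<^sup>2 / (- c k)) powr (1 / (2 * real k)) * (\<beta> - 1 / a) powr (1 / (2 * real k)))"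
    unfolding a .
  have crit: "is_critical_inverse_temperature X T \<psi> (1 / a)"
    unfolding a by (rule S.critical_inverse_temperature)
  have "a * (a\<^sup>2 / (- c k)) powr (1 / (2 * real k)) > 0"
    using pos neg by simp
  with crit asymp have "is_critical_exponent X T \<psi> (1 / (2 * real k))"
    unfolding is_critical_exponent_def by blast
  with crit asymp
  show "is_critical_inverse_temperature X T \<psi> (1 / a) \<and>
      positive_equilibrium_value X T \<psi> \<sim>[at_right (1 / a)]
        (\<lambda>\<beta>. a * (a\<^sup>2 / (- c k)) powr (1 / (2 * real k)) * (\<beta> - 1 / a) powr (1 / (2 * real k))) \<and>
      is_critical_exponent X T \<psi> (1 / (2 * real k))" by blast
qed

section \<open>Families of systems\<close>

theorem corollary6p11:
  fixes \<Theta> :: "(real ^ 'q) set"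
    and X :: "real ^ 'q \<Rightarrow> 'a metric"
    and T :: "real ^ 'q \<Rightarrow> 'a \<Rightarrow> 'a set"
    and \<psi> :: "real ^ 'q \<Rightarrow> 'a \<times> 'a \<Rightarrow> real"
    and P :: "real ^ 'q \<Rightarrow> real \<Rightarrow> real"
    and a :: "real ^ 'q \<Rightarrow> real"
    and c :: "real ^ 'q \<Rightarrow> nat \<Rightarrow> real"
    and C :: "nat \<Rightarrow> real ^ 'q \<Rightarrow> real"
    and S :: "nat \<Rightarrow> (real ^ 'q) set"
  defines "P \<equiv> \<lambda>\<theta>. pressure_fun (X \<theta>) (T \<theta>) (\<psi> \<theta>)"
    and "a \<equiv> \<lambda>\<theta>. pressure_lin_coeff (P \<theta>)"
    and "c \<equiv> \<lambda>\<theta>. pressure_odd_coeff (P \<theta>)"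
    and "C \<equiv> \<lambda>k \<theta>. a \<theta> * ((a \<theta>)\<^sup>2 / (- c \<theta> k)) powr (1 / (2 * real k))"
    and "S \<equiv> stratum \<Theta> c"
  assumes "open \<Theta>"
    and "\<And>\<theta>. \<theta> \<in> \<Theta> \<Longrightarrow> compact_space (mtopology_of (X \<theta>))"
    and "\<And>\<theta>. \<theta> \<in> \<Theta> \<Longrightarrow> correspondence (X \<theta>) (T \<theta>)"
    and "\<And>\<theta>. \<theta> \<in> \<Theta> \<Longrightarrow> forward_expansive (X \<theta>) (T \<theta>)"
    and "\<And>\<theta>. \<theta> \<in> \<Theta> \<Longrightarrow> continuous_map (graph_topology (X \<theta>) (T \<theta>)) euclideanreal (\<psi> \<theta>)"
    and "\<And>\<theta>. \<theta> \<in> \<Theta> \<Longrightarrow> legendre_assumptions (X \<theta>) (T \<theta>) (\<psi> \<theta>)"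
    and "\<And>\<theta>. \<theta> \<in> \<Theta> \<Longrightarrow> unique_linear_equilibrium_pairs (X \<theta>) (T \<theta>) (\<psi> \<theta>)"
    and "\<And>\<theta>. \<theta> \<in> \<Theta> \<Longrightarrow>
           uminus ` rotation_set (X \<theta>) (T \<theta>) (\<psi> \<theta>) = rotation_set (X \<theta>) (T \<theta>) (\<psi> \<theta>)"
    and "\<And>\<theta> y. \<theta> \<in> \<Theta> \<Longrightarrow> P \<theta> (- y) = P \<theta> y"
    and "\<exists>U. open U \<and> \<Theta> \<times> {0} \<subseteq> U \<and> U \<subseteq> \<Theta> \<times> UNIV \<and> real_analytic_on (\<lambda>(\<theta>, y). P \<theta> y) U"
    and "\<And>\<theta>. \<theta> \<in> \<Theta> \<Longrightarrow> strict_mono_on {0<..} (\<lambda>y. y / deriv (P \<theta>) y)"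
  shows
    "(\<comment> \<open>the expansion defining the coefficients\<close>
      \<forall>\<theta>\<in>\<Theta>. a \<theta> > 0 \<and>
        (\<forall>\<^sub>F y in nhds 0.
           (\<lambda>j. c \<theta> (Suc j) * y ^ (2 * Suc j + 1)) sums (deriv (P \<theta>) y - a \<theta> * y))) \<and>
     (\<comment> \<open>(i)\<close>
      \<forall>k\<ge>1.
        (\<forall>\<theta>\<in>S k.
           is_critical_inverse_temperature (X \<theta>) (T \<theta>) (\<psi> \<theta>) (1 / a \<theta>) \<and>
           positive_equilibrium_value (X \<theta>) (T \<theta>) (\<psi> \<theta>) \<sim>[at_right (1 / a \<theta>)]
             (\<lambda>\<beta>. C k \<theta> * (\<beta> - 1 / a \<theta>) powr (1 / (2 * real k))) \<and>
           is_critical_exponent (X \<theta>) (T \<theta>) (\<psi> \<theta>) (1 / (2 * real k))) \<and>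
        (let U = {\<theta>\<in>\<Theta>. a \<theta> > 0 \<and> c \<theta> k < 0} in
           open U \<and> S k \<subseteq> U \<and>
           real_analytic_on (\<lambda>\<theta>. 1 / a \<theta>) U \<and> real_analytic_on (C k) U)) \<and>
     (\<comment> \<open>(ii)\<close>
      \<forall>k\<ge>1. \<forall>\<theta>\<in>S k. \<forall>\<theta>'\<in>\<Theta>. \<forall>j\<ge>1.
        j < k \<and> (\<forall>i. 1 \<le> i \<and> i < j \<longrightarrow> c \<theta>' i = 0) \<and> c \<theta>' j < 0 \<longrightarrow>
        is_critical_exponent (X \<theta>') (T \<theta>') (\<psi> \<theta>') (1 / (2 * real j)))"
proof -
  have sys: "a \<theta> > 0"
      "\<forall>\<^sub>F y in nhds 0. (\<lambda>j. c \<theta> (Suc j) * y ^ (2 * Suc j + 1)) sums (deriv (P \<theta>) y - a \<theta> * y)"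
      "\<And>k. 1 \<le> k \<Longrightarrow> \<theta> \<in> S k \<Longrightarrow>
        is_critical_inverse_temperature (X \<theta>) (T \<theta>) (\<psi> \<theta>) (1 / a \<theta>) \<and>
        positive_equilibrium_value (X \<theta>) (T \<theta>) (\<psi> \<theta>) \<sim>[at_right (1 / a \<theta>)]
          (\<lambda>\<beta>. C k \<theta> * (\<beta> - 1 / a \<theta>) powr (1 / (2 * real k))) \<and>
        is_critical_exponent (X \<theta>) (T \<theta>) (\<psi> \<theta>) (1 / (2 * real k))"
    if \<theta>: "\<theta> \<in> \<Theta>" for \<theta>
  proof -
    note hyps = assms(7)[OF \<theta>] assms(8)[OF \<theta>] assms(10)[OF \<theta>] assms(11)[OF \<theta>] assms(12)[OF \<theta>]
      assms(14)[OF \<theta>, unfolded P_def] assms(16)[OF \<theta>, unfolded P_def]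
    note crit = critical_behaviour[OF hyps]
    show "a \<theta> > 0" unfolding a_def P_def by (rule crit(1))
    show "\<forall>\<^sub>F y in nhds 0. (\<lambda>j. c \<theta> (Suc j) * y ^ (2 * Suc j + 1)) sums (deriv (P \<theta>) y - a \<theta> * y)"
      unfolding a_def c_def P_def by (rule crit(2))
    fix k :: nat assume k: "1 \<le> k" and "\<theta> \<in> S k"
    hence "\<And>i. 1 \<le> i \<Longrightarrow> i < k \<Longrightarrow> c \<theta> i = 0" "c \<theta> k < 0"
      by (auto simp: S_def stratum_def)
    from crit(3)[OF k this[unfolded c_def P_def]]
    show "is_critical_inverse_temperature (X \<theta>) (T \<theta>) (\<psi> \<theta>) (1 / a \<theta>) \<and>
        positive_equilibrium_value (X \<theta>) (T \<theta>) (\<psi> \<theta>) \<sim>[at_right (1 / a \<theta>)]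
          (\<lambda>\<beta>. C k \<theta> * (\<beta> - 1 / a \<theta>) powr (1 / (2 * real k))) \<and>
        is_critical_exponent (X \<theta>) (T \<theta>) (\<psi> \<theta>) (1 / (2 * real k))"
      unfolding C_def a_def c_def P_def .
  qed
  obtain W where W: "\<Theta> \<times> {0} \<subseteq> W" "real_analytic_on (\<lambda>(\<theta>, y). P \<theta> y) W"
    using assms(15) by blast
  note coeff = real_analytic_on_coefficient[OF W(2,1)]
  have an_a: "real_analytic_on a \<Theta>"
  proof -
    have "a = (\<lambda>\<theta>. (deriv ^^ 2) (P \<theta>) 0)"
      by (simp add: a_def pressure_lin_coeff_def numeral_2_eq_2)
    thus ?thesis using coeff[of 2] by simp
  qed
  have an_c: "real_analytic_on (\<lambda>\<theta>. c \<theta> k) \<Theta>" for k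
  proof -
    have "c \<theta> k = (1 / fact (2 * k + 1)) * (deriv ^^ Suc (2 * k + 1)) (P \<theta>) 0" for \<theta>
      unfolding c_def pressure_odd_coeff_def funpow_Suc_right comp_def by simp
    thus ?thesis using real_analytic_on_cmult[OF coeff[of "Suc (2 * k + 1)"], of "1 / fact (2 * k + 1)"]
      by presburger
  qed
  have analytic: "let U = {\<theta>\<in>\<Theta>. a \<theta> > 0 \<and> c \<theta> k < 0} in
           open U \<and> S k \<subseteq> U \<and>
           real_analytic_on (\<lambda>\<theta>. 1 / a \<theta>) U \<and> real_analytic_on (C k) U" for k
  proof -
    have "S k \<subseteq> {\<theta>\<in>\<Theta>. a \<theta> > 0 \<and> c \<theta> k < 0}"
      using sys(1) by (auto simp: S_def stratum_def)
    thus ?thesis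
      using real_analytic_critical_parameters[OF an_a an_c[of k] \<open>open \<Theta>\<close>] unfolding Let_def C_def by blast
  qed
  have S_\<Theta>: "S k \<subseteq> \<Theta>" for k by (auto simp: S_def stratum_def)
  have "is_critical_exponent (X \<theta>') (T \<theta>') (\<psi> \<theta>') (1 / (2 * real j))"
    if "\<theta>' \<in> \<Theta>" "1 \<le> j" "\<forall>i. 1 \<le> i \<and> i < j \<longrightarrow> c \<theta>' i = 0" "c \<theta>' j < 0" for \<theta>' j
  proof -
    have "\<theta>' \<in> S j" using that by (simp add: S_def stratum_def)
    thus ?thesis using sys(3) that by blast
  qed
  with sys analytic S_\<Theta> show ?thesis by blast
qed

end
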